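(* Let $p\ge 2$ be an integer and let $n\in\mathbf N_0$ satisfy $$n(z)=-\frac{s_0}{z}-\frac{s_1}{z^2}-\cdots-\frac{s_{2p}}{z^{2p+1}}+\mathrm o\!\left(\frac1{z^{2p+1}}\right),\qquad z=iy,\ y\to\pm\infty,$$ with $D_p=\det(s_{i+j})_{i,j=0}^{p}\neq 0$. Let $$\widehat n(z)=\frac{-s_0}{n(z)}-z+\frac{s_1}{s_0}$$ be the Schur transform of $n$. Let $e_k$ and $d_k$, $k=0,1,\dots,p$, be the polynomials of first and second kind associated with $n$, and let $\widehat e_k$ and $\widehat d_k$, $k=0,1,\dots,p-1$, be the polynomials of first and second kind associated with $\widehat n$. Then for $k=0,1,\dots,p-1$ $$\widehat e_k(z)=\frac{1}{\sqrt{s_0}}\,d_{k+1}(z),$$ $$\widehat d_k(z)=-\sqrt{s_0}\,e_{k+1}(z)+\frac1{\sqrt{s_0}}\left(z-\frac{s_1}{s_0}\right)d_{k+1}(z) = b_0\left(\frac{e_{k+1}(z)-e_{k+1}(\cdot)}{z-\cdot},\,e_1\right)=\frac1{\sqrt{s_0}}\left(\frac{e_{k+1}(z)-e_{k+1}(\cdot)}{z-\cdot},\ \cdot-a_0\right),$$ where $a_0=\frac{s_1}{s_0}$, $b_0=\frac{\sqrt{s_2s_0-s_1^2}}{s_0}$, and $(\cdot,\cdot)$ is the inner product of $L^2(\sigma)$, $\sigma$ being the measure in the representation $n(z)=\int_{\mathbb R}\frac{d\sigma(t)}{t-z}$.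
   Context: A Nevanlinna function is a function $n$ that is analytic in the open upper half plane $\mathbb C^+$ with $\operatorname{Im} n(z)\ge 0$ for $z\in\mathbb C^+$; it is always extended to the lower half plane by $n(z)=n(z^* )^*$, where $z^*$ denotes the complex conjugate. $\mathbf N_0$ denotes the set of all Nevanlinna functions. For $m\in\mathbf N_0$ and an integer $q\ge0$, suppose $m(z)=-\frac{s_0}{z}-\cdots-\frac{s_{2q}}{z^{2q+1}}+\mathrm o(z^{-2q-1})$ for $z=iy$, $y\to\pm\infty$ (the $s_j$ are real). Then $m(z)=\int_{\mathbb R}\frac{d\sigma(t)}{t-z}$ with a unique finite positive Borel measure $\sigma$ on $\mathbb R$, and $s_j=\int t^j\,d\sigma(t)$, $j=0,\dots,2q$. Suppose further $\det(s_{i+j})_{i,j=0}^q\ne0$. The polynomials of the first kind $e_0,\dots,e_q$ associated with $m$ are the polynomials obtained by Gram–Schmidt orthonormalization of $1,t,\dots,t^q$ in $L^2(\sigma)$: $e_k$ is a real polynomial of degree $k$ with positive leading coefficient and $\int e_je_k\,d\sigma=\delta_{jk}$; in particular $e_0=1/\sqrt{s_0}$. The polynomials of the second kind associated with $m$ are $$d_k(z)=\int_{\mathbb R}\frac{e_k(z)-e_k(t)}{z-t}\,d\sigma(t),\qquad k=0,1,\dots,q .$$ In the situation of the claim, the Schur transform $\widehat n$ belongs to $\mathbf N_0$, has an asymptotic expansion $\widehat n(z)=-\frac{\widehat s_0}{z}-\frac{\widehat s_1}{z^2}-\cdots-\frac{\widehat s_{2p-2}}{z^{2p-1}}+\mathrm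 o(z^{-2p+1})$ for $z=iy$, $y\to\pm\infty$, with real coefficients $\widehat s_j$, and its corresponding Hankel determinant $\det(\widehat s_{i+j})_{i,j=0}^{p-1}$ of order $p$ is nonzero, so that $\widehat e_k,\widehat d_k$ ($k\le p-1$) are defined (taking $m=\widehat n$ and $q=p-1$) with respect to the measure $\widehat\sigma$ of $\widehat n$. In expressions such as $\left(\frac{e(z)-e(\cdot)}{z-\cdot},\,\cdot-a_0\right)$ the dot denotes the integration variable $t$. *)

theory Defs
  imports
    "HOL-Probability.Probability"
    "HOL-Library.Landau_Symbols"
    "HOL-Computational_Algebra.Polynomial"
    "Jordan_Normal_Form.Determinant"
begin

text \<open>Values on the real axis are unconstrained: there \<open>n\<close> is mathematically undefined.\<close>

definition nevanlinna :: "(complex \<Rightarrow> complex) set" where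
  "nevanlinna = {n. n holomorphic_on {z. Im z > 0}
     \<and> (\<forall>z. Im z > 0 \<longrightarrow> Im (n z) \<ge> 0)
     \<and> (\<forall>z. Im z < 0 \<longrightarrow> n z = cnj (n (cnj z)))}"

text \<open>The filter \<^term>\<open>at_infinity :: real filter\<close> is \<^term>\<open>sup at_top at_bot :: real filter\<close>,
  that is, \<open>y \<rightarrow> \<plusminus>\<infinity>\<close>. Only \<open>s 0, \<dots>, s (2 * q)\<close> matter.\<close>

definition has_moment_expansion :: "(complex \<Rightarrow> complex) \<Rightarrow> (nat \<Rightarrow> real) \<Rightarrow> nat \<Rightarrow> bool" where
  "has_moment_expansion m s q \<longleftrightarrow>
     (\<lambda>y::real. m (\<i> * of_real y) - (\<Sum>j\<le>2*q. - of_real (s j) / (\<i> * of_real y) ^ (j+1)))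
       \<in> o[at_infinity](\<lambda>y. 1 / (\<i> * of_real y) ^ (2*q+1))"

definition hankel_det :: "(nat \<Rightarrow> real) \<Rightarrow> nat \<Rightarrow> real" where
  "hankel_det s q = Determinant.det (Matrix.mat (q+1) (q+1) (\<lambda>(i, j). s (i + j)))"

definition schur_transform ::
  "(nat \<Rightarrow> real) \<Rightarrow> (complex \<Rightarrow> complex) \<Rightarrow> complex \<Rightarrow> complex" where
  "schur_transform s n z = - of_real (s 0) / n z - z + of_real (s 1 / s 0)"

definition represents :: "real measure \<Rightarrow> (complex \<Rightarrow> complex) \<Rightarrow> bool" where
  "represents \<sigma> m \<longleftrightarrow> finite_borel_measure \<sigma> \<and>
     (\<forall>z. Im z \<noteq> 0 \<longrightarrow> m z = (\<integral>t. 1 / (of_real t - z) \<partial>\<sigma>))"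

text \<open>By Stieltjes inversion at most one measure represents \<open>m\<close>, so the choice is immaterial.
  If \<open>m\<close> is a Nevanlinna function with a moment expansion, such a measure exists.\<close>

definition spectral_measure :: "(complex \<Rightarrow> complex) \<Rightarrow> real measure" where
  "spectral_measure m = (SOME \<sigma>. represents \<sigma> m)"

text \<open>Gram--Schmidt applied to \<open>1, t, t\<^sup>2, \<dots>\<close> in \<open>L\<^sup>2(\<sigma>)\<close>. It is meaningful up to index \<open>q\<close>
  when \<open>\<sigma>\<close> has moments up to order \<open>2 * q\<close> and a nonzero Hankel determinant of size \<open>q + 1\<close>.\<close>

fun orthonormal_poly :: "real measure \<Rightarrow> nat \<Rightarrow> real poly" where
  "orthonormal_poly \<sigma> k =
     (let u = Polynomial.monom 1 k
            - (\<Sum>j<k. Polynomial.smult (\<integral>t. t ^ k * poly (orthonormal_poly \<sigma> j) t \<partial>\<sigma>) (orthonormal_poly \<sigma> j))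
      in Polynomial.smult (1 / sqrt (\<integral>t. (poly u t)\<^sup>2 \<partial>\<sigma>)) u)"

declare orthonormal_poly.simps [simp del]

definition first_kind :: "(complex \<Rightarrow> complex) \<Rightarrow> nat \<Rightarrow> real poly" where
  "first_kind m k = orthonormal_poly (spectral_measure m) k"

definition cpoly :: "real poly \<Rightarrow> complex \<Rightarrow> complex" where
  "cpoly P z = poly (map_poly of_real P) z"

text \<open>The quotient \<open>(P(z) - P(t)) / (z - t)\<close>, understood as a polynomial in \<open>z\<close> and \<open>t\<close>; its value
  at \<open>t = z\<close> matters when \<open>z\<close> is real and an atom of the measure.\<close>

definition diff_quot :: "real poly \<Rightarrow> complex \<Rightarrow> real \<Rightarrow> complex" where
  "diff_quot P z t = (if z = of_real t then cpoly (pderiv P) z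
                      else (cpoly P z - cpoly P (of_real t)) / (z - of_real t))"

definition second_kind :: "(complex \<Rightarrow> complex) \<Rightarrow> nat \<Rightarrow> complex \<Rightarrow> complex" where
  "second_kind m k z = (\<integral>t. diff_quot (first_kind m k) z t \<partial>spectral_measure m)"

definition L2_inner :: "real measure \<Rightarrow> (real \<Rightarrow> complex) \<Rightarrow> (real \<Rightarrow> complex) \<Rightarrow> complex" where
  "L2_inner \<sigma> f g = (\<integral>t. f t * cnj (g t) \<partial>\<sigma>)"

end

theory Submission
  imports Defs "HOL-Complex_Analysis.Complex_Analysis"
begin

text \<open>Comparing coefficients in \<open>n(z) (n'(z) + z - a\<^sub>0) = - s\<^sub>0\<close> gives a convolution relation between the
  moments \<open>s\<^sub>j\<close> of \<open>n\<close> and the moments \<open>s'\<^sub>j\<close> of its Schur transform \<open>n'\<close>. With \<open>L\<close>, \<open>L'\<close> the two moment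
  functionals and \<open>D P(z) = L\<^sub>t [(P(t) - P(z)) / (t - z)]\<close>, \<open>D'\<close> likewise, it amounts to
  \<open>L [(t - a\<^sub>0) P Q] = L' [Q D P] + L [P D' Q]\<close>. For \<open>P = e\<^sub>k\<^sub>+\<^sub>1\<close> the last term vanishes when \<open>deg Q \<le> k\<close>, so
  orthogonality of the \<open>e\<^sub>k\<close> turns into orthogonality of the \<open>D e\<^sub>k\<^sub>+\<^sub>1\<close> with respect to \<open>L'\<close>. The formula
  for the polynomials of the second kind is \<open>D' (D P) = (z - a\<^sub>0) D P - s\<^sub>0 P + L P\<close>.

  On the analytic side, the Schwarz--Pick inequality between \<open>z\<close> and \<open>iy\<close>, \<open>y \<rightarrow> \<infinity>\<close>, yields
  \<open>Im z |n(z)|\<^sup>2 \<le> s\<^sub>0 Im n(z)\<close>. This says that \<open>n'\<close> is a Nevanlinna function, and it bounds \<open>n\<close> on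
  every half plane \<open>Im z \<ge> \<epsilon>\<close>, so that Poisson's formula on the lines \<open>Im z = \<epsilon>\<close> and Helly's theorem
  produce the representing measures.\<close>

subsection \<open>Moment functionals and associated polynomials\<close>

text \<open>Only \<open>s 0, ..., s (2 * p)\<close> are moments of the measure; later entries of the
  sequence are arbitrary. So the algebra runs over functionals on all polynomials, defined from
  sequences: \<open>schur_moment\<close> comes from a formal power series in all of
  \<open>s\<close>, the convolution relation holds at every index, and degrees are bounded only
  where a functional is compared with an integral.

  The measure behind \<open>first_kind\<close> and \<open>second_kind\<close> is a choice, which
  says nothing until some representing measure exists. Hence the integral representation must be
  established, for n' as well as for n. Hamburger's argument then turns the asymptotic expansions
  into moments of the chosen measures.

  Positive definiteness comes from the Hankel determinant of n. For n', Gram--Schmidt is identified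
  by uniqueness: the scaled D e_{k+1} are orthonormal with positive leading coefficients, and
  Gram--Schmidt returns any such system.

  The inner products in the claim come from t - a_0 = (z - a_0) - (z - t), where z - t cancels the
  denominator of the difference quotient.\<close>

lemma poly_monom_add_induct [case_names monom add]:
  fixes p :: "'a::comm_monoid_add poly"
  assumes "\<And>a i. P (Polynomial.monom a i)" and "\<And>p q. P p \<Longrightarrow> P q \<Longrightarrow> P (p + q)"
  shows "P p"
proof -
  have "P (\<Sum>i\<in>I. Polynomial.monom (poly.coeff p i) i)" if "finite I" for I
    using that
  proof (induction I)
    case empty
    then show ?case using assms(1)[of 0 0] by simp
  qed (simp add: assms)
  then have "P (\<Sum>i\<le>Polynomial.degree p. Polynomial.monom (poly.coeff p i) i)"
    by blast
  then show ?thesis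
    by (simp add: poly_as_sum_of_monoms)
qed

text \<open>Built from the sequence and not from a measure, so that it is linear on all polynomials,
  also on those whose degree exceeds the order of the existing moments.
  \<open>has_moments_poly\<close> links it to integration.\<close>

definition moment_functional :: "(nat \<Rightarrow> real) \<Rightarrow> real poly \<Rightarrow> real" where
  "moment_functional s P = (\<Sum>i\<le>Polynomial.degree P. poly.coeff P i * s i)"

lemma moment_functional_eq:
  assumes "Polynomial.degree P \<le> N"
  shows "moment_functional s P = (\<Sum>i\<le>N. poly.coeff P i * s i)"
  unfolding moment_functional_def
  using assms by (intro sum.mono_neutral_left) (auto simp: coeff_eq_0)

lemma moment_functional_0 [simp]: "moment_functional s 0 = 0"
  by (simp add: moment_functional_def)

lemma moment_functional_add:
  "moment_functional s (P + Q) = moment_functional s P + moment_functional s Q"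
proof -
  let ?N = "max (Polynomial.degree P) (Polynomial.degree Q)"
  have "Polynomial.degree (P + Q) \<le> ?N"
    by (rule degree_add_le) auto
  then show ?thesis
    by (simp add: moment_functional_eq[where N="?N"] sum.distrib distrib_right)
qed

lemma moment_functional_smult [simp]:
  "moment_functional s (Polynomial.smult c P) = c * moment_functional s P"
  using moment_functional_eq[OF degree_smult_le[of c P], of s]
  by (simp add: moment_functional_def sum_distrib_left mult.assoc)

lemma moment_functional_uminus [simp]:
  "moment_functional s (- P) = - moment_functional s P"
  using moment_functional_smult[of s "-1" P] by simp

lemma moment_functional_diff:
  "moment_functional s (P - Q) = moment_functional s P - moment_functional s Q"
  using moment_functional_add[of s P "- Q"] by simp

lemma moment_functional_sum:
  "moment_functional s (\<Sum>i\<in>I. f i) = (\<Sum>i\<in>I. moment_functional s (f i))"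
  by (induction I rule: infinite_finite_induct) (auto simp: moment_functional_add)

lemma moment_functional_monom [simp]:
  "moment_functional s (Polynomial.monom c i) = c * s i"
proof -
  have "moment_functional s (Polynomial.monom c i)
      = (\<Sum>j\<le>i. poly.coeff (Polynomial.monom c i) j * s j)"
    by (rule moment_functional_eq) (rule degree_monom_le)
  also have "\<dots> = (\<Sum>j\<in>{i}. poly.coeff (Polynomial.monom c i) j * s j)"
    by (rule sum.mono_neutral_right) auto
  finally show ?thesis
    by simp
qed

lemma moment_functional_pCons:
  "moment_functional s (pCons a P) = a * s 0 + moment_functional s (pCons 0 P)"
proof -
  have "pCons a P = Polynomial.monom a 0 + pCons 0 P"
    by (simp add: monom_0)
  then have "moment_functional s (pCons a P) = moment_functional s (Polynomial.monom a 0 + pCons 0 P)"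
    by (rule arg_cong)
  then show ?thesis
    unfolding moment_functional_add by simp
qed

text \<open>The D P of the overview: (P(t) - P(z)) / (t - z) is the sum over i of z^i times the
  value of \<open>poly_shift (Suc i) P\<close> at t, and the functional acts on t.\<close>

definition assoc_poly :: "(nat \<Rightarrow> real) \<Rightarrow> real poly \<Rightarrow> real poly" where
  "assoc_poly s P =
     (\<Sum>i\<le>Polynomial.degree P. Polynomial.monom (moment_functional s (poly_shift (Suc i) P)) i)"

lemma coeff_assoc_poly:
  "poly.coeff (assoc_poly s P) i = moment_functional s (poly_shift (Suc i) P)"
proof -
  have "poly_shift (Suc i) P = 0" if "i > Polynomial.degree P"
    using that by (intro poly_eqI) (auto simp: coeff_poly_shift coeff_eq_0)
  then show ?thesis
    by (auto simp: assoc_poly_def coeff_sum if_distrib cong: if_cong)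
qed

lemma assoc_poly_0 [simp]: "assoc_poly s 0 = 0"
  by (simp add: assoc_poly_def)

text \<open>For a + t P(t) the kernel is P(t) + z (P(t) - P(z)) / (t - z). This recursion drives the
  inductions below; \<open>diff_quot_pCons\<close> is its counterpart under the integral.\<close>

lemma assoc_poly_pCons:
  "assoc_poly s (pCons a P) = pCons (moment_functional s P) (assoc_poly s P)"
proof (rule poly_eqI)
  fix i
  have "poly_shift (Suc k) (pCons a P) = poly_shift k P" for k
    by (rule poly_eqI) (simp add: coeff_poly_shift)
  moreover have "poly_shift 0 P = P"
    by (rule poly_eqI) (simp add: coeff_poly_shift)
  ultimately show "poly.coeff (assoc_poly s (pCons a P)) i
      = poly.coeff (pCons (moment_functional s P) (assoc_poly s P)) i"
    by (cases i) (simp_all add: coeff_assoc_poly)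
qed

lemma assoc_poly_add: "assoc_poly s (P + Q) = assoc_poly s P + assoc_poly s Q"
proof (rule poly_eqI)
  fix i
  have "poly_shift k (P + Q) = poly_shift k P + poly_shift k Q" for k
    by (rule poly_eqI) (simp add: coeff_poly_shift)
  then show "poly.coeff (assoc_poly s (P + Q)) i = poly.coeff (assoc_poly s P + assoc_poly s Q) i"
    by (simp add: coeff_assoc_poly moment_functional_add)
qed

lemma assoc_poly_smult: "assoc_poly s (Polynomial.smult c P) = Polynomial.smult c (assoc_poly s P)"
proof (rule poly_eqI)
  fix i
  have "poly_shift k (Polynomial.smult c P) = Polynomial.smult c (poly_shift k P)" for k
    by (rule poly_eqI) (simp add: coeff_poly_shift)
  then show "poly.coeff (assoc_poly s (Polynomial.smult c P)) i
      = poly.coeff (Polynomial.smult c (assoc_poly s P)) i"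
    by (simp add: coeff_assoc_poly)
qed

lemma assoc_poly_monom:
  "assoc_poly s (Polynomial.monom c m) = (\<Sum>i<m. Polynomial.monom (c * s (m - 1 - i)) i)"
proof (induction m)
  case 0
  then show ?case by (simp add: monom_0 assoc_poly_pCons)
next
  case (Suc m)
  have "(\<Sum>i<k. pCons 0 (f i)) = pCons 0 (\<Sum>i<k. f i)" for f :: "nat \<Rightarrow> real poly" and k
    by (induction k) simp_all
  then show ?case
    by (simp add: Suc assoc_poly_pCons monom_Suc sum.lessThan_Suc_shift monom_0 del: sum.lessThan_Suc)
qed

lemma degree_assoc_poly_le: "Polynomial.degree (assoc_poly s P) \<le> Polynomial.degree P - 1"
proof (rule degree_le, intro allI impI)
  fix i assume "Polynomial.degree P - 1 < i"
  then have "poly_shift (Suc i) P = 0"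
    by (intro poly_eqI) (auto simp: coeff_poly_shift coeff_eq_0)
  then show "poly.coeff (assoc_poly s P) i = 0"
    by (simp add: coeff_assoc_poly)
qed

lemma lead_coeff_assoc_poly:
  assumes "Polynomial.degree P = Suc k"
  shows "poly.coeff (assoc_poly s P) k = s 0 * poly.coeff P (Suc k)"
proof -
  have "poly_shift (Suc k) P = Polynomial.monom (poly.coeff P (Suc k)) 0"
    using assms by (intro poly_eqI) (auto simp: coeff_poly_shift coeff_eq_0)
  then show ?thesis
    by (simp add: coeff_assoc_poly)
qed

lemma tendsto_inverse_imaginary: "((\<lambda>y. 1 / (\<i> * of_real y :: complex)) \<longlongrightarrow> 0) at_top"
proof -
  have "((\<lambda>y. - \<i> * of_real (inverse y)) \<longlongrightarrow> - \<i> * of_real 0) at_top"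
    by (intro tendsto_intros tendsto_inverse_0_at_top filterlim_ident)
  then show ?thesis
    by (simp add: divide_inverse)
qed

text \<open>The moment condition only makes sense up to the degree \<open>N\<close>: higher moments need not exist.\<close>

definition has_moments :: "real measure \<Rightarrow> (nat \<Rightarrow> real) \<Rightarrow> nat \<Rightarrow> bool" where
  "has_moments \<sigma> s N \<longleftrightarrow>
     (\<forall>j\<le>N. integrable \<sigma> (\<lambda>t. t ^ j) \<and> (\<integral>t. t ^ j \<partial>\<sigma>) = s j)"

text \<open>In terms of the formal Stieltjes series \<open>N(z) = - (\<Sum>j. s j / z ^ (j + 1))\<close> and
  \<open>N'(z) = - (\<Sum>j. s' j / z ^ (j + 1))\<close>, this is the relation \<open>N(z) (N'(z) + z - a) = - s 0\<close>.\<close>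

locale schur_moments =
  fixes s s' :: "nat \<Rightarrow> real" and a :: real
  assumes convolution: "s (Suc m) - a * s m = (\<Sum>i<m. s i * s' (m - 1 - i))"
begin

text \<open>Both sides are linear in Q, and on monomials the claim is the convolution relation
  itself. It is the case P = 1 of \<open>functional_product\<close>.\<close>

lemma functional_shift:
  "moment_functional s ([:- a, 1:] * Q) = moment_functional s (assoc_poly s' Q)"
proof (induction Q rule: poly_monom_add_induct)
  case (monom c i)
  have "[:- a, 1:] * Polynomial.monom c i = Polynomial.monom c (Suc i) - Polynomial.monom (a * c) i"
    by (simp add: monom_Suc smult_monom minus_monom[symmetric])
  then have "moment_functional s ([:- a, 1:] * Polynomial.monom c i) = c * (s (Suc i) - a * s i)"
    by (simp only: moment_functional_diff moment_functional_monom) (simp add: algebra_simps)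
  then show ?case
    by (simp add: convolution assoc_poly_monom moment_functional_sum sum_distrib_left mult_ac)
next
  case (add p q)
  then show ?case
    by (simp only: distrib_left moment_functional_add assoc_poly_add)
qed

text \<open>Induction on P with Q free: a factor t of P is moved over to Q. The recursions for D' (t
  Q) and D (t P) each produce the product of \<open>moment_functional s P\<close> and
  \<open>moment_functional s' Q\<close>, one on either side, so the identity persists. The constant
  term of P is covered by \<open>functional_shift\<close>.\<close>

lemma functional_product:
  "moment_functional s ([:- a, 1:] * P * Q)
     = moment_functional s' (Q * assoc_poly s P) + moment_functional s (P * assoc_poly s' Q)"
proof (induction P arbitrary: Q)
  case 0
  then show ?case by simp
next
  case (pCons c P)
  have split: "pCons c P = [:c:] + pCons 0 P"
    by simp
  have "[:- a, 1:] * [:c:] * Q = Polynomial.smult c ([:- a, 1:] * Q)"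
    by (simp add: smult_diff_right mult.commute)
  then have "moment_functional s ([:- a, 1:] * [:c:] * Q) = c * moment_functional s (assoc_poly s' Q)"
    by (simp only: moment_functional_smult functional_shift)
  moreover have "moment_functional s ([:- a, 1:] * pCons 0 P * Q)
      = moment_functional s' (Q * assoc_poly s (pCons c P))
        + moment_functional s (pCons 0 P * assoc_poly s' Q)"
    using pCons.IH[of "pCons 0 Q"]
    by (simp add: assoc_poly_pCons moment_functional_add algebra_simps)
  ultimately show ?case
    unfolding split distrib_left distrib_right
    by (simp add: moment_functional_add split[symmetric])
qed

text \<open>The new constant term in each induction step is L' (D P), which
  \<open>functional_product\<close> with Q = 1 evaluates as L ((t - a) P), because D' 1 = 0.\<close>

lemma assoc_assoc_poly:
  "assoc_poly s' (assoc_poly s P)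
     = [:- a, 1:] * assoc_poly s P - Polynomial.smult (s 0) P + [:moment_functional s P:]"
proof (induction P)
  case 0
  then show ?case by simp
next
  case (pCons c P)
  have "assoc_poly s' 1 = 0"
    by (simp add: one_pCons assoc_poly_pCons)
  then have "moment_functional s' (assoc_poly s P)
      = moment_functional s (pCons 0 P) - a * moment_functional s P"
    using functional_product[of P 1] by (simp add: moment_functional_diff)
  then show ?case
    unfolding assoc_poly_pCons[of s c P] assoc_poly_pCons[of s'] pCons.IH
    by (simp add: moment_functional_pCons[of s c P] algebra_simps)
qed

end

subsection \<open>Orthonormal polynomials\<close>

lemma has_moments_poly:
  assumes "has_moments \<sigma> s N" "Polynomial.degree P \<le> N"
  shows "integrable \<sigma> (poly P)" "(\<integral>t. poly P t \<partial>\<sigma>) = moment_functional s P"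
proof -
  have P: "poly P = (\<lambda>t. \<Sum>i\<le>Polynomial.degree P. poly.coeff P i * t ^ i)"
    by (simp add: poly_altdef fun_eq_iff)
  have int: "integrable \<sigma> (\<lambda>t. poly.coeff P i * t ^ i)" if "i \<le> Polynomial.degree P" for i
    using assms that by (auto simp: has_moments_def)
  show "integrable \<sigma> (poly P)"
    unfolding P by (intro Bochner_Integration.integrable_sum int) auto
  have "(\<integral>t. poly P t \<partial>\<sigma>) = (\<Sum>i\<le>Polynomial.degree P. poly.coeff P i * s i)"
    unfolding P using assms int
    by (subst Bochner_Integration.integral_sum) (auto simp: has_moments_def)
  then show "(\<integral>t. poly P t \<partial>\<sigma>) = moment_functional s P"
    by (simp add: moment_functional_def)
qed

text \<open>Positive leading coefficients belong to the notion because they exclude sign changes and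
  thereby make the system unique.\<close>

definition orthonormal_upto :: "(nat \<Rightarrow> real) \<Rightarrow> (nat \<Rightarrow> real poly) \<Rightarrow> nat \<Rightarrow> bool" where
  "orthonormal_upto s f q \<longleftrightarrow>
     (\<forall>k\<le>q. Polynomial.degree (f k) = k \<and> poly.coeff (f k) k > 0) \<and>
     (\<forall>j\<le>q. \<forall>k\<le>q. moment_functional s (f j * f k) = (if j = k then 1 else 0))"

text \<open>Subtracting the multiple of \<open>f k\<close> that cancels the leading coefficient
  leaves a combination of the earlier \<open>f j\<close>, which is orthogonal to \<open>f k\<close>;
  hence the coefficients are inner products.\<close>

lemma orthonormal_expansion:
  assumes "orthonormal_upto s f q" "Polynomial.degree P \<le> k" "k \<le> q"
  shows "P = (\<Sum>j\<le>k. Polynomial.smult (moment_functional s (P * f j)) (f j))"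
  using assms(2,3)
proof (induction k arbitrary: P rule: less_induct)
  case (less k)
  define c where "c = poly.coeff P k / poly.coeff (f k) k"
  define Q where "Q = P - Polynomial.smult c (f k)"
  have fk: "Polynomial.degree (f k) = k" "poly.coeff (f k) k > 0"
    using assms(1) less.prems by (auto simp: orthonormal_upto_def)
  have ortho: "moment_functional s (f i * f j) = (if i = j then 1 else 0)" if "i \<le> k" "j \<le> k" for i j
    using assms(1) less.prems that by (auto simp: orthonormal_upto_def)
  have Qdeg: "Polynomial.degree Q \<le> k"
    unfolding Q_def using less.prems fk by (intro degree_diff_le) auto
  have Qk: "poly.coeff Q k = 0"
    using fk by (simp add: Q_def c_def)
  have P: "P = Q + Polynomial.smult c (f k)"
    by (simp add: Q_def)
  have Q: "Q = (\<Sum>j<k. Polynomial.smult (moment_functional s (Q * f j)) (f j))"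
  proof (cases k)
    case 0
    then have "Q = 0"
      using Qdeg Qk by (metis le_zero_eq leading_coeff_0_iff)
    then show ?thesis using 0 by simp
  next
    case (Suc m)
    have "Polynomial.degree Q \<le> m"
      using Qdeg Qk Suc leading_coeff_0_iff[of Q] by (cases "Polynomial.degree Q = k") auto
    from less.IH[OF _ this] less.prems Suc show ?thesis
      by (simp add: lessThan_Suc_atMost)
  qed
  have "moment_functional s (Q * f k) = 0"
    by (subst Q) (simp add: sum_distrib_right moment_functional_sum ortho)
  then have "moment_functional s (P * f j) = (if j = k then c else moment_functional s (Q * f j))"
    if "j \<le> k" for j
    using that by (simp add: P distrib_right moment_functional_add ortho)
  then have "(\<Sum>j\<le>k. Polynomial.smult (moment_functional s (P * f j)) (f j))
      = (\<Sum>j<k. Polynomial.smult (moment_functional s (Q * f j)) (f j)) + Polynomial.smult c (f k)"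
    by (simp add: lessThan_Suc_atMost[symmetric])
  also have "\<dots> = P"
    using Q P by simp
  finally show ?case ..
qed

text \<open>Every integrand in the Gram--Schmidt step of index k has degree at most 2 k \<le> 2 q,
  so its integral can be replaced by the moment functional.\<close>

lemma orthonormal_poly_altdef:
  assumes mom: "has_moments \<sigma> s (2 * q)" and "k \<le> q"
    and deg: "\<And>j. j < k \<Longrightarrow> Polynomial.degree (orthonormal_poly \<sigma> j) \<le> j"
  defines "u \<equiv> Polynomial.monom 1 k - (\<Sum>j<k. Polynomial.smult
             (moment_functional s (Polynomial.monom 1 k * orthonormal_poly \<sigma> j)) (orthonormal_poly \<sigma> j))"
  shows "orthonormal_poly \<sigma> k = Polynomial.smult (1 / sqrt (moment_functional s (u * u))) u"
    and "Polynomial.degree u = k" and "poly.coeff u k = 1"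
proof -
  have "(\<integral>t. t ^ k * poly (orthonormal_poly \<sigma> j) t \<partial>\<sigma>)
      = moment_functional s (Polynomial.monom 1 k * orthonormal_poly \<sigma> j)" if "j < k" for j
  proof -
    have "Polynomial.degree (Polynomial.monom 1 k * orthonormal_poly \<sigma> j) \<le> k + j"
      using deg[OF that] by (intro degree_mult_le[THEN order_trans]) (simp add: degree_monom_eq)
    with that \<open>k \<le> q\<close> show ?thesis
      using has_moments_poly(2)[OF mom, of "Polynomial.monom 1 k * orthonormal_poly \<sigma> j"]
      by (simp add: poly_monom)
  qed
  then have u: "u = Polynomial.monom 1 k
      - (\<Sum>j<k. Polynomial.smult (\<integral>t. t ^ k * poly (orthonormal_poly \<sigma> j) t \<partial>\<sigma>) (orthonormal_poly \<sigma> j))"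
    by (simp add: u_def)
  have small: "poly.coeff (\<Sum>j<k. Polynomial.smult (c j) (orthonormal_poly \<sigma> j)) i = 0"
    if "i \<ge> k" for i and c :: "nat \<Rightarrow> real"
  proof -
    have "poly.coeff (orthonormal_poly \<sigma> j) i = 0" if "j < k" for j
      using deg[OF that] that \<open>i \<ge> k\<close> by (intro coeff_eq_0) simp
    then show ?thesis by (simp add: coeff_sum)
  qed
  show c1: "poly.coeff u k = 1"
    by (simp add: u_def small)
  have "Polynomial.degree u \<le> k"
    by (rule degree_le) (auto simp: u_def small)
  with c1 show degu: "Polynomial.degree u = k"
    using le_degree[of u k] by simp
  have "Polynomial.degree (u * u) \<le> 2 * q"
    using degree_mult_le[of u u] degu \<open>k \<le> q\<close> by simp
  then have "(\<integral>t. (poly u t)\<^sup>2 \<partial>\<sigma>) = moment_functional s (u * u)"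
    using has_moments_poly(2)[OF mom, of "u * u"] by (simp add: power2_eq_square)
  then show "orthonormal_poly \<sigma> k = Polynomial.smult (1 / sqrt (moment_functional s (u * u))) u"
    by (subst orthonormal_poly.simps) (simp add: Let_def u)
qed

text \<open>In the expansion of t^k along f, Gram--Schmidt removes all terms but the last, a
  multiple \<open>c\<close> of \<open>f k\<close>. Leading coefficients give c > 0, so normalisation
  returns \<open>f k\<close>. This is what identifies the polynomials of the Schur
  transform.\<close>

lemma orthonormal_poly_unique:
  assumes mom: "has_moments \<sigma> s (2 * q)" and f: "orthonormal_upto s f q" and "k \<le> q"
  shows "orthonormal_poly \<sigma> k = f k"
  using \<open>k \<le> q\<close>
proof (induction k rule: less_induct)
  case (less k)
  define P where "P = (Polynomial.monom 1 k :: real poly)"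
  have IH: "orthonormal_poly \<sigma> j = f j" if "j < k" for j
    using less that by simp
  have deg: "Polynomial.degree (f j) = j" "poly.coeff (f j) j > 0" if "j \<le> k" for j
    using f less.prems that by (auto simp: orthonormal_upto_def)
  define u where "u = P - (\<Sum>j<k. Polynomial.smult (moment_functional s (P * f j)) (f j))"
  have e: "orthonormal_poly \<sigma> k = Polynomial.smult (1 / sqrt (moment_functional s (u * u))) u"
    and ck: "poly.coeff u k = 1"
    using orthonormal_poly_altdef[OF mom less.prems] deg by (simp_all add: IH u_def P_def)
  define c where "c = moment_functional s (P * f k)"
  have "P = (\<Sum>j\<le>k. Polynomial.smult (moment_functional s (P * f j)) (f j))"
    by (rule orthonormal_expansion[OF f _ less.prems]) (simp add: P_def degree_monom_le)
  then have u: "u = Polynomial.smult c (f k)"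
    by (simp add: u_def c_def lessThan_Suc_atMost[symmetric] algebra_simps)
  then have "c * poly.coeff (f k) k = 1"
    using ck by simp
  then have "c > 0"
    using deg(2)[of k] zero_less_mult_pos2[of c "poly.coeff (f k) k"] by simp
  moreover have "moment_functional s (u * u) = c\<^sup>2"
    using f less.prems by (simp add: u orthonormal_upto_def power2_eq_square)
  ultimately show ?case
    unfolding e by (simp add: u)
qed

text \<open>Positivity on squares keeps every normalising root nonzero. The induction carries
  orthogonality to smaller indices only; commutativity of the product supplies the rest.\<close>

lemma orthonormal_poly_exists:
  assumes mom: "has_moments \<sigma> s (2 * q)"
    and pos: "\<And>P. P \<noteq> 0 \<Longrightarrow> Polynomial.degree P \<le> q \<Longrightarrow> moment_functional s (P * P) > 0"
  shows "orthonormal_upto s (orthonormal_poly \<sigma>) q"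
proof -
  let ?e = "orthonormal_poly \<sigma>"
  have *: "Polynomial.degree (?e k) = k \<and> poly.coeff (?e k) k > 0 \<and>
        (\<forall>j\<le>k. moment_functional s (?e k * ?e j) = (if j = k then 1 else 0))" if "k \<le> q" for k
    using that
  proof (induction k rule: less_induct)
    case (less k)
    define P where "P = (Polynomial.monom 1 k :: real poly)"
    define u where "u = P - (\<Sum>j<k. Polynomial.smult (moment_functional s (P * ?e j)) (?e j))"
    have IH: "Polynomial.degree (?e j) = j"
      "i \<le> j \<Longrightarrow> moment_functional s (?e j * ?e i) = (if i = j then 1 else 0)" if "j < k" for i j
      using less that by auto
    have ortho: "moment_functional s (?e i * ?e j) = (if i = j then 1 else 0)" if "i < k" "j < k" for i j
      using IH(2)[of i j] IH(2)[of j i] that by (cases "i \<le> j") (auto simp: mult.commute)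
    have e: "?e k = Polynomial.smult (1 / sqrt (moment_functional s (u * u))) u"
      and deg: "Polynomial.degree u = k" and ck: "poly.coeff u k = 1"
      using orthonormal_poly_altdef[OF mom less.prems] IH(1) by (simp_all add: u_def P_def)
    have "u \<noteq> 0"
      using ck by auto
    then have upos: "moment_functional s (u * u) > 0"
      using deg less.prems by (intro pos) auto
    have "moment_functional s (u * ?e i) = 0" if "i < k" for i
    proof -
      have "moment_functional s (u * ?e i) = moment_functional s (P * ?e i)
          - (\<Sum>j<k. moment_functional s (P * ?e j) * moment_functional s (?e j * ?e i))"
        by (simp add: u_def left_diff_distrib moment_functional_diff sum_distrib_right moment_functional_sum)
      also have "(\<Sum>j<k. moment_functional s (P * ?e j) * moment_functional s (?e j * ?e i))
          = (\<Sum>j<k. if j = i then moment_functional s (P * ?e i) else 0)"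
        using that by (intro sum.cong) (auto simp: ortho)
      finally show ?thesis
        using that by simp
    qed
    moreover have "1 / sqrt x * (1 / sqrt x * x) = 1" if "x > 0" for x :: real
      using that by (simp add: field_simps)
    ultimately have "moment_functional s (?e k * ?e j) = (if j = k then 1 else 0)" if "j \<le> k" for j
      using that upos by (cases "j = k") (simp_all add: e)
    with upos ck deg show ?case
      by (auto simp: e)
  qed
  have "moment_functional s (?e j * ?e k) = (if j = k then 1 else 0)"
    if "j \<le> q" "k \<le> q" for j k
  proof (cases "j \<le> k")
    case True
    then show ?thesis
      using *[of k] that by (subst mult.commute) auto
  next
    case False
    then show ?thesis
      using *[of j] that by auto
  qed
  with * show ?thesis
    by (auto simp: orthonormal_upto_def)
qed

text \<open>L (P P) is the integral of a square. If it vanished, P would be zero almost everywhere,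
  all L (P t^i) would vanish, and the coefficient vector of P would lie in the kernel of the Hankel
  matrix.\<close>

lemma hankel_positive_definite:
  assumes mom: "has_moments \<sigma> s (2 * q)" and det: "hankel_det s q \<noteq> 0"
    and "P \<noteq> 0" "Polynomial.degree P \<le> q"
  shows "moment_functional s (P * P) > 0"
proof (rule ccontr)
  assume neg: "\<not> moment_functional s (P * P) > 0"
  have deg: "Polynomial.degree (P * R) \<le> 2 * q" if "Polynomial.degree R \<le> q" for R
    using degree_mult_le[of P R] that assms(4) by linarith
  have "moment_functional s (P * P) = (\<integral>t. poly P t * poly P t \<partial>\<sigma>)"
    using has_moments_poly(2)[OF mom deg[OF assms(4)]] by simp
  moreover have "0 \<le> (\<integral>t. poly P t * poly P t \<partial>\<sigma>)"
    by simp
  ultimately have "(\<integral>t. poly P t * poly P t \<partial>\<sigma>) = 0"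
    using neg by linarith
  moreover have "integrable \<sigma> (\<lambda>t. poly P t * poly P t)"
    using has_moments_poly(1)[OF mom deg[OF assms(4)]] by (simp add: poly_mult[abs_def])
  ultimately have AE0: "AE t in \<sigma>. poly P t = 0"
    by (subst (asm) integral_nonneg_eq_0_iff_AE) auto
  define A where "A = Matrix.mat (q+1) (q+1) (\<lambda>(i, j). s (i + j))"
  define v where "v = Matrix.vec (q+1) (poly.coeff P)"
  have A: "A \<in> carrier_mat (q+1) (q+1)" and v: "v \<in> carrier_vec (q+1)"
    by (auto simp: A_def v_def)
  have "poly.coeff P (Polynomial.degree P) \<noteq> 0"
    using assms(3) by simp
  then have "v $ Polynomial.degree P \<noteq> 0"
    using assms(4) by (simp add: v_def)
  then have "v \<noteq> 0\<^sub>v (q+1)"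
    using assms(4) by auto
  moreover have "A *\<^sub>v v = 0\<^sub>v (q+1)"
  proof (rule eq_vecI)
    fix i assume "i < dim_vec (0\<^sub>v (q+1))"
    then have i: "i \<le> q" by simp
    have "(A *\<^sub>v v) $ i = (\<Sum>j<Suc q. s (i + j) * poly.coeff P j)"
      using i by (simp add: A_def v_def scalar_prod_def atLeast0LessThan)
    also have "\<dots> = (\<Sum>j\<le>q. poly.coeff P j * s (i + j))"
      by (simp add: lessThan_Suc_atMost mult.commute)
    also have "\<dots> = (\<Sum>j\<le>Polynomial.degree P. poly.coeff P j * s (i + j))"
      using assms(4) by (intro sum.mono_neutral_right) (auto simp: coeff_eq_0)
    also have "\<dots> = moment_functional s (\<Sum>j\<le>Polynomial.degree P.
          Polynomial.monom (poly.coeff P j) j * Polynomial.monom 1 i)"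
      by (simp add: moment_functional_sum mult_monom add.commute)
    also have "\<dots> = moment_functional s (P * Polynomial.monom 1 i)"
      by (simp add: sum_distrib_right[symmetric] poly_as_sum_of_monoms)
    also have "\<dots> = (\<integral>t. poly (P * Polynomial.monom 1 i) t \<partial>\<sigma>)"
      using i by (intro has_moments_poly(2)[OF mom, symmetric] deg) (simp add: degree_monom_eq)
    also have "\<dots> = (\<integral>t. 0 \<partial>\<sigma>)"
      using AE0 has_moments_poly(1)[OF mom deg, of "Polynomial.monom 1 i"] i
      by (intro integral_cong_AE) (auto simp: degree_monom_eq poly_mult[abs_def])
    finally show "(A *\<^sub>v v) $ i = 0\<^sub>v (q+1) $ i"
      using i by simp
  qed (simp add: A_def)
  ultimately have "Determinant.det A = 0"
    using det_0_iff_vec_prod_zero[OF A] v by blast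
  then show False
    using det by (simp add: hankel_det_def A_def)
qed

section \<open>Orthonormal systems under the Schur transform\<close>

context schur_moments
begin

text \<open>Taking \<open>Q = assoc_poly s (e (k + 1))\<close> in \<open>functional_product\<close> leaves only the leading
  coefficient of \<open>Q\<close>, because \<open>e (k + 1)\<close> is orthogonal to lower degrees.\<close>

lemma orthonormal_transform:
  assumes e: "orthonormal_upto s e p" and s0: "s 0 > 0" and "q < p"
  shows "orthonormal_upto s' (\<lambda>k. Polynomial.smult (1 / sqrt (s 0)) (assoc_poly s (e (Suc k)))) q"
proof -
  define f where "f k = assoc_poly s (e (Suc k))" for k
  have edeg: "Polynomial.degree (e k) = k" "poly.coeff (e k) k > 0" if "k \<le> p" for k
    using e that by (auto simp: orthonormal_upto_def)
  have low: "moment_functional s (e k * R) = 0" if "k \<le> p" "Polynomial.degree R < k" for k R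
  proof -
    have "R = (\<Sum>j\<le>Polynomial.degree R. Polynomial.smult (moment_functional s (R * e j)) (e j))"
      using that by (intro orthonormal_expansion[OF e]) auto
    then have "moment_functional s (e k * R) = moment_functional s
        (e k * (\<Sum>j\<le>Polynomial.degree R. Polynomial.smult (moment_functional s (R * e j)) (e j)))"
      by simp
    also have "\<dots> = (\<Sum>j\<le>Polynomial.degree R. moment_functional s (R * e j) * moment_functional s (e k * e j))"
      by (simp add: sum_distrib_left moment_functional_sum)
    also have "\<dots> = 0"
      using that e by (intro sum.neutral) (auto simp: orthonormal_upto_def)
    finally show ?thesis .
  qed
  have fcoeff: "poly.coeff (f k) k = s 0 * poly.coeff (e (Suc k)) (Suc k)" if "k < p" for k
    unfolding f_def using that edeg[of "Suc k"] by (intro lead_coeff_assoc_poly) auto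
  have fdeg: "Polynomial.degree (f k) = k" if "k < p" for k
  proof (rule antisym)
    show "Polynomial.degree (f k) \<le> k"
      unfolding f_def using degree_assoc_poly_le[of s "e (Suc k)"] edeg[of "Suc k"] that by simp
    show "k \<le> Polynomial.degree (f k)"
      using fcoeff[OF that] edeg(2)[of "Suc k"] s0 that by (intro le_degree) simp
  qed
  have main: "moment_functional s' (Q * f k) = moment_functional s ([:- a, 1:] * e (Suc k) * Q)"
    if "k < p" "Polynomial.degree Q \<le> k" for k Q
  proof -
    have "Polynomial.degree (assoc_poly s' Q) < Suc k"
      using degree_assoc_poly_le[of s' Q] that by simp
    then show ?thesis
      using functional_product[of "e (Suc k)" Q] low[of "Suc k"] that by (simp add: f_def)
  qed
  have lower: "moment_functional s' (f j * f k) = 0" if "j < k" "k < p" for j k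
  proof -
    have "Polynomial.degree ([:- a, 1:] * f j) \<le> 1 + j"
      using degree_mult_le[of "[:- a, 1:]" "f j"] fdeg[of j] that by simp
    then have "moment_functional s (e (Suc k) * ([:- a, 1:] * f j)) = 0"
      using that by (intro low) auto
    then show ?thesis
      using main[of k "f j"] that fdeg[of j] by (simp only: mult_ac)
  qed
  have diag: "moment_functional s' (f k * f k) = s 0" if "k < p" for k
  proof -
    define g where "g = [:- a, 1:] * f k"
    have g: "g = pCons 0 (f k) - Polynomial.smult a (f k)"
      by (simp add: g_def)
    \<comment> \<open>By \<open>lead_coeff_assoc_poly\<close> the leading coefficient of
      \<open>g\<close> is \<open>s 0\<close> times that of \<open>e (Suc k)\<close>, so
      \<open>R\<close> has degree at most k and is orthogonal to \<open>e (Suc k)\<close>.\<close>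
    define R where "R = g - Polynomial.smult (s 0) (e (Suc k))"
    have "poly.coeff R i = 0" if "i > k" for i
      using that fcoeff[OF \<open>k < p\<close>] fdeg[OF \<open>k < p\<close>] edeg[of "Suc k"] \<open>k < p\<close>
      by (cases "i = Suc k") (auto simp: R_def g coeff_eq_0 coeff_pCons split: nat.splits)
    then have "Polynomial.degree R < Suc k"
      by (simp add: degree_le less_Suc_eq_le)
    then have "moment_functional s (e (Suc k) * R) = 0"
      using that by (intro low) auto
    moreover have "moment_functional s (e (Suc k) * e (Suc k)) = 1"
      using e that by (auto simp: orthonormal_upto_def)
    ultimately have "moment_functional s (e (Suc k) * g) = s 0"
      by (simp add: R_def right_diff_distrib moment_functional_diff)
    then show ?thesis
      using main[OF that, of "f k"] fdeg[OF that] by (simp add: g_def mult_ac del: mult_pCons_left mult_pCons_right)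
  qed
  have "moment_functional s' (f j * f k) = (if j = k then s 0 else 0)" if "j < p" "k < p" for j k
    using lower[of j k] lower[of k j] diag[of k] that by (cases j k rule: linorder_cases) (auto simp: mult.commute)
  then show ?thesis
    unfolding orthonormal_upto_def f_def[symmetric]
    using \<open>q < p\<close> s0 fdeg fcoeff edeg(2)[of "Suc _"] by auto
qed

end

subsection \<open>Moments from the asymptotic expansion\<close>

text \<open>The truncated integrands increase to g, so monotone convergence delivers the
  integrability of g together with its integral. \<open>Suc n\<close> keeps the denominator positive
  at t = 0.\<close>

lemma integral_truncation_limit:
  fixes g :: "real \<Rightarrow> real"
  assumes g: "g \<in> borel_measurable M" "\<And>t. g t \<ge> 0" and [measurable_cong]: "sets M = sets borel"
    and int: "\<And>n::nat. integrable M (\<lambda>t. g t * (real (Suc n))\<^sup>2 / (t\<^sup>2 + (real (Suc n))\<^sup>2))"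
    and lim: "(\<lambda>n::nat. \<integral>t. g t * (real (Suc n))\<^sup>2 / (t\<^sup>2 + (real (Suc n))\<^sup>2) \<partial>M) \<longlonglongrightarrow> c"
  shows "integrable M g" "(\<integral>t. g t \<partial>M) = c"
proof -
  let ?f = "\<lambda>n t. g t * (real (Suc n))\<^sup>2 / (t\<^sup>2 + (real (Suc n))\<^sup>2)"
  have mono: "AE t in M. mono (\<lambda>n. ?f n t)"
  proof (rule AE_I2, rule monoI)
    fix t :: real and m n :: nat assume mn: "m \<le> n"
    have "(real (Suc m))\<^sup>2 / (t\<^sup>2 + (real (Suc m))\<^sup>2) \<le> (real (Suc n))\<^sup>2 / (t\<^sup>2 + (real (Suc n))\<^sup>2)"
    proof -
      have "(real (Suc m))\<^sup>2 \<le> (real (Suc n))\<^sup>2"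
        using mn by (intro power_mono) auto
      then have "t\<^sup>2 * (real (Suc m))\<^sup>2 \<le> t\<^sup>2 * (real (Suc n))\<^sup>2"
        by (intro mult_left_mono) auto
      then show ?thesis
        by (intro frac_le_eq[THEN iffD2]  divide_nonpos_pos)
           (auto simp: field_simps sum_power2_eq_zero_iff intro!: mult_pos_pos add_nonneg_pos)
    qed
    then show "?f m t \<le> ?f n t"
      unfolding times_divide_eq_right[symmetric] by (rule mult_left_mono) (rule g(2))
  qed
  have ptw: "AE t in M. (\<lambda>n. ?f n t) \<longlonglongrightarrow> g t"
  proof (rule AE_I2)
    fix t :: real
    have "(\<lambda>n. g t * (1 / (t\<^sup>2 * (1 / real (Suc n))\<^sup>2 + 1))) \<longlonglongrightarrow> g t * (1 / (t\<^sup>2 * 0\<^sup>2 + 1))"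
      by (intro tendsto_intros LIMSEQ_Suc[OF lim_1_over_n]) auto
    moreover have "g t * (1 / (t\<^sup>2 * (1 / real (Suc n))\<^sup>2 + 1)) = ?f n t" for n
      by (simp add: divide_simps add_pos_nonneg)
    ultimately show "(\<lambda>n. ?f n t) \<longlonglongrightarrow> g t"
      by simp
  qed
  show "integrable M g"
    by (rule integrable_monotone_convergence[OF int mono ptw lim g(1)])
  show "(\<integral>t. g t \<partial>M) = c"
    by (rule integral_monotone_convergence[OF int mono ptw lim g(1)])
qed

lemma has_moment_expansion_tendsto:
  assumes "has_moment_expansion m s q"
  shows "((\<lambda>y. (\<i> * of_real y) ^ (2*q+1) *
            (m (\<i> * of_real y) + (\<Sum>j\<le>2*q. of_real (s j) / (\<i> * of_real y) ^ (j+1)))) \<longlongrightarrow> 0) at_top"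
proof -
  have "((\<lambda>y::real. (m (\<i> * of_real y) - (\<Sum>j\<le>2*q. - of_real (s j) / (\<i> * of_real y) ^ (j+1)))
      / (1 / (\<i> * of_real y) ^ (2*q+1))) \<longlongrightarrow> 0) at_infinity"
    using assms unfolding has_moment_expansion_def by (rule smalloD_tendsto)
  then have "((\<lambda>y::real. (m (\<i> * of_real y) - (\<Sum>j\<le>2*q. - of_real (s j) / (\<i> * of_real y) ^ (j+1)))
      / (1 / (\<i> * of_real y) ^ (2*q+1))) \<longlongrightarrow> 0) at_top"
    by (rule tendsto_mono[OF at_top_le_at_infinity])
  then show ?thesis
    by (simp add: sum_negf mult.commute)
qed

lemma has_moment_expansion_lead:
  assumes "has_moment_expansion m s q"
  shows "((\<lambda>y. \<i> * of_real y * m (\<i> * of_real y)) \<longlongrightarrow> - of_real (s 0)) at_top"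
proof -
  let ?z = "\<lambda>y::real. \<i> * of_real y"
  have inv: "((\<lambda>y. 1 / ?z y) \<longlongrightarrow> 0) at_top"
    by (rule tendsto_inverse_imaginary)
  have "((\<lambda>y. (1 / ?z y) ^ (2*q) * (?z y ^ (2*q+1) * (m (?z y) + (\<Sum>j\<le>2*q. of_real (s j) / ?z y ^ (j+1))))
      - (\<Sum>j\<le>2*q. of_real (s j) * (1 / ?z y) ^ j)) \<longlongrightarrow> 0 ^ (2*q) * 0 - (\<Sum>j\<le>2*q. of_real (s j) * 0 ^ j)) at_top"
    by (intro tendsto_intros inv has_moment_expansion_tendsto[OF assms])
  moreover have "(\<Sum>j\<le>2*q. of_real (s j) * 0 ^ j) = (of_real (s 0) :: complex)"
    by (simp add: power_0_left if_distrib cong: if_cong)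
  moreover have "\<forall>\<^sub>F y in at_top. (1 / ?z y) ^ (2*q) * (?z y ^ (2*q+1) *
        (m (?z y) + (\<Sum>j\<le>2*q. of_real (s j) / ?z y ^ (j+1))))
      - (\<Sum>j\<le>2*q. of_real (s j) * (1 / ?z y) ^ j) = ?z y * m (?z y)"
    using eventually_gt_at_top[of "0::real"]
  proof eventually_elim
    case (elim y)
    then have z: "?z y \<noteq> 0" by simp
    have "(\<Sum>j\<le>2*q. of_real (s j) * (1 / ?z y) ^ j) = ?z y * (\<Sum>j\<le>2*q. of_real (s j) / ?z y ^ (j+1))"
      using z by (simp add: sum_distrib_left power_one_over)
    then show ?case
      using z by (simp add: power_one_over distrib_left)
  qed
  ultimately show ?thesis
    by (simp add: tendsto_cong)
qed

text \<open>Hamburger's argument, by induction on the order: once the moments up to 2 k are known,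
  the remainder of the expansion is an integral whose real part yields the moment 2 k + 2 and whose
  imaginary part yields the moment 2 k + 1.\<close>

lemma has_moments_of_expansion:
  assumes rep: "represents \<sigma> m" and exp: "has_moment_expansion m s q"
  shows "has_moments \<sigma> s (2*q)"
proof -
  let ?z = "\<lambda>y::real. \<i> * of_real y"
  interpret finite_borel_measure \<sigma>
    using rep by (simp add: represents_def)
  have [measurable_cong]: "sets \<sigma> = sets borel"
    by (rule M_is_borel)
  have kernel: "1 / (of_real t - ?z y) = Complex (t / (t\<^sup>2 + y\<^sup>2)) (y / (t\<^sup>2 + y\<^sup>2))" if "y > 0" for t y :: real
    by (simp add: complex_eq_iff Re_divide Im_divide power2_eq_square)
  have posd: "t\<^sup>2 + y\<^sup>2 > 0" if "y > 0" for t y :: real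
    using that by (simp add: add_nonneg_pos)
  have m: "m (?z y) = (\<integral>t. 1 / (of_real t - ?z y) \<partial>\<sigma>)" if "y > 0" for y
    using rep that by (simp add: represents_def)
  have intk: "integrable \<sigma> (\<lambda>t. 1 / (of_real t - ?z y))" if "y > 0" for y
  proof (rule integrable_const_bound[where B="1 / y"])
    have "norm (1 / (of_real t - ?z y)) \<le> 1 / y" for t
      using that abs_Im_le_cmod[of "of_real t - ?z y"] by (simp add: norm_divide frac_le)
    then show "AE t in \<sigma>. norm (1 / (of_real t - ?z y)) \<le> 1 / y"
      by simp
  qed measurable
  \<comment> \<open>The expansion of order 2 k as a limit along the positive imaginary axis; the
    induction step has to cut the expansion of order 2 k + 2 back to this form.\<close>
  define E where "E k = ((\<lambda>y. ?z y ^ (2*k+1) *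
            (m (?z y) + (\<Sum>j\<le>2*k. of_real (s j) / ?z y ^ (j+1)))) \<longlongrightarrow> 0) at_top" for k
  have "E k \<Longrightarrow> has_moments \<sigma> s (2*k)" for k
  proof (induction k)
    case 0
    have "((\<lambda>y. ?z y * (m (?z y) + of_real (s 0) / ?z y)) \<longlongrightarrow> 0) at_top"
      using 0 by (simp add: E_def)
    from tendsto_Re[OF this] have "((\<lambda>y. Re (?z y * (m (?z y) + of_real (s 0) / ?z y))) \<longlongrightarrow> 0) at_top"
      by simp
    from filterlim_compose[OF this filterlim_real_sequentially, THEN LIMSEQ_Suc]
    have first: "(\<lambda>n. s 0 - Re (?z (real (Suc n)) * (m (?z (real (Suc n))) + of_real (s 0) / ?z (real (Suc n)))))
        \<longlonglongrightarrow> s 0 - 0"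
      by (intro tendsto_intros) (simp add: o_def)
    have int1: "integrable \<sigma> (\<lambda>t. y\<^sup>2 / (t\<^sup>2 + y\<^sup>2))" and
      eq1: "s 0 - Re (?z y * (m (?z y) + of_real (s 0) / ?z y)) = (\<integral>t. y\<^sup>2 / (t\<^sup>2 + y\<^sup>2) \<partial>\<sigma>)"
      if "y > 0" for y
    proof -
      have k: "y\<^sup>2 / (t\<^sup>2 + y\<^sup>2) = y * Im (1 / (of_real t - ?z y))" for t
        unfolding kernel[OF that] by (simp add: power2_eq_square)
      show "integrable \<sigma> (\<lambda>t. y\<^sup>2 / (t\<^sup>2 + y\<^sup>2))"
        unfolding k by (intro integrable_mult_right integrable_Im intk that)
      have "(\<integral>t. y\<^sup>2 / (t\<^sup>2 + y\<^sup>2) \<partial>\<sigma>) = y * Im (m (?z y))"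
        unfolding k m[OF that] by (simp add: integral_Im[OF intk[OF that]])
      also have "\<dots> = s 0 - Re (?z y * m (?z y) + ?z y * (of_real (s 0) / ?z y))"
        using that by simp
      finally show "s 0 - Re (?z y * (m (?z y) + of_real (s 0) / ?z y)) = (\<integral>t. y\<^sup>2 / (t\<^sup>2 + y\<^sup>2) \<partial>\<sigma>)"
        by (simp only: distrib_left)
    qed
    have "(\<lambda>n. \<integral>t. (real (Suc n))\<^sup>2 / (t\<^sup>2 + (real (Suc n))\<^sup>2) \<partial>\<sigma>) \<longlonglongrightarrow> s 0 - 0"
      by (subst eq1[symmetric], simp, rule first)
    then have "(\<integral>t. 1 \<partial>\<sigma>) = s 0"
      using int1 by (intro integral_truncation_limit(2)[OF _ _ M_is_borel]) (simp_all del: of_nat_Suc)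
    then show ?case
      by (simp add: has_moments_def)
  next
    case (Suc k)
    have inv: "((\<lambda>y. 1 / ?z y) \<longlongrightarrow> 0) at_top"
      by (rule tendsto_inverse_imaginary)
    define r where "r y = ?z y ^ (2*k+1) * (m (?z y) + (\<Sum>j\<le>2*k. of_real (s j) / ?z y ^ (j+1)))" for y
    \<comment> \<open>The expansion of order 2 k + 2 written through the remainder \<open>r\<close>
      of order 2 k. Division by the square of z gives \<open>E k\<close>; its real and imaginary
      parts later give the two new moments.\<close>
    have lim: "((\<lambda>y. ?z y ^ 2 * r y + ?z y * of_real (s (2*k+1)) + of_real (s (2*k+2))) \<longlongrightarrow> 0) at_top"
    proof (rule Lim_transform_eventually)
      show "((\<lambda>y. ?z y ^ (2 * Suc k+1) *
            (m (?z y) + (\<Sum>j\<le>2 * Suc k. of_real (s j) / ?z y ^ (j+1)))) \<longlongrightarrow> 0) at_top"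
        using Suc.prems by (simp add: E_def)
      show "\<forall>\<^sub>F y in at_top. ?z y ^ (2 * Suc k+1) *
            (m (?z y) + (\<Sum>j\<le>2 * Suc k. of_real (s j) / ?z y ^ (j+1))) =
          ?z y ^ 2 * r y + ?z y * of_real (s (2*k+1)) + of_real (s (2*k+2))"
        using eventually_gt_at_top[of "0::real"]
      proof eventually_elim
        case (elim y)
        define z where "z = ?z y"
        have "z \<noteq> 0" using elim by (simp add: z_def)
        then have "z ^ (2 * Suc k+1) * (of_real (s (2*k+1)) / z ^ (2*k+2)) = z * of_real (s (2*k+1))"
          "z ^ (2 * Suc k+1) * (of_real (s (2*k+2)) / z ^ (2*k+3)) = of_real (s (2*k+2))"
          by (simp_all add: field_simps numeral_3_eq_3)
        moreover have "z ^ (2 * Suc k+1) = z ^ 2 * z ^ (2*k+1)"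
          by (simp add: power2_eq_square)
        moreover have "2 * Suc k = Suc (Suc (2*k))" by simp
        ultimately show ?case
          unfolding r_def z_def[symmetric]
          by (simp add: distrib_left numeral_3_eq_3 mult_ac power2_eq_square)
      qed
    qed
    have "((\<lambda>y. (1 / ?z y)^2 * (?z y ^ 2 * r y + ?z y * of_real (s (2*k+1)) + of_real (s (2*k+2)))
        - (1 / ?z y) * of_real (s (2*k+1)) - (1 / ?z y)^2 * of_real (s (2*k+2)))
        \<longlongrightarrow> 0^2 * 0 - 0 * of_real (s (2*k+1)) - 0^2 * of_real (s (2*k+2))) at_top"
      by (intro tendsto_intros inv lim)
    moreover have "\<forall>\<^sub>F y in at_top. (1 / ?z y)^2 * (?z y ^ 2 * r y + ?z y * of_real (s (2*k+1)) + of_real (s (2*k+2)))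
        - (1 / ?z y) * of_real (s (2*k+1)) - (1 / ?z y)^2 * of_real (s (2*k+2)) = r y"
      using eventually_gt_at_top[of "0::real"]
    proof eventually_elim
      case (elim y)
      define z where "z = ?z y"
      have "z \<noteq> 0" using elim by (simp add: z_def)
      then show ?case
        unfolding z_def[symmetric] by (simp add: field_simps power2_eq_square)
    qed
    ultimately have "(r \<longlongrightarrow> 0) at_top"
      by (simp add: tendsto_cong)
    then have "E k"
      unfolding E_def r_def[abs_def] .
    then have mom: "has_moments \<sigma> s (2*k)"
      by (rule Suc.IH)
    then have intp: "integrable \<sigma> (\<lambda>t. t ^ j)" "(\<integral>t. t ^ j \<partial>\<sigma>) = s j" if "j \<le> 2*k" for j
      using that by (auto simp: has_moments_def)
    \<comment> \<open>Finite geometric sum: removing the first 2 k + 1 terms of the expansion of the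
      Cauchy kernel in powers of 1/z leaves (t/z)^(2 k + 1) / (t - z).\<close>
    have geo: "of_real t ^ (2*k+1) / (of_real t - ?z y)
        = ?z y ^ (2*k+1) * (1 / (of_real t - ?z y) + (\<Sum>j\<le>2*k. of_real (t ^ j) / ?z y ^ (j+1)))"
      if "y > 0" for t y
    proof -
      define z where "z = ?z y"
      define w where "w = complex_of_real t"
      have z: "z \<noteq> 0" "w - z \<noteq> 0" using that by (auto simp: z_def w_def complex_eq_iff)
      have "(\<Sum>j\<le>2*k. w ^ j / z ^ (j+1)) * z ^ (2*k+1) = (\<Sum>j<2*k+1. w ^ j * z ^ (2*k+1 - Suc j))"
        unfolding sum_distrib_right
        by (rule sum.cong) (use z in \<open>auto simp: power_diff\<close>)
      then have "(w - z) * ((\<Sum>j\<le>2*k. w ^ j / z ^ (j+1)) * z ^ (2*k+1)) = w ^ (2*k+1) - z ^ (2*k+1)"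
        using diff_power_eq_sum[of w "2*k" z] by (simp add: mult.commute)
      then have "w ^ (2*k+1) = (w - z) * (z ^ (2*k+1) * (1 / (w - z) + (\<Sum>j\<le>2*k. w ^ j / z ^ (j+1))))"
        using z by (simp add: field_simps)
      then show ?thesis
        using z unfolding z_def[symmetric] w_def[symmetric] of_real_power
        by (metis nonzero_mult_div_cancel_left)
    qed
    have intr: "integrable \<sigma> (\<lambda>t. of_real t ^ (2*k+1) / (of_real t - ?z y))"
      and r: "r y = (\<integral>t. of_real t ^ (2*k+1) / (of_real t - ?z y) \<partial>\<sigma>)" if "y > 0" for y
    proof -
      have ints: "integrable \<sigma> (\<lambda>t. of_real (t ^ j) / ?z y ^ (j+1))" if "j \<le> 2*k" for j
        using intp(1)[OF that] by (intro integrable_divide integrable_of_real)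
      show "integrable \<sigma> (\<lambda>t. of_real t ^ (2*k+1) / (of_real t - ?z y))"
        unfolding geo[OF that]
        by (intro integrable_mult_right Bochner_Integration.integrable_add intk that
            Bochner_Integration.integrable_sum ints) auto
      have "(\<integral>t. 1 / (of_real t - ?z y) + (\<Sum>j\<le>2*k. of_real (t ^ j) / ?z y ^ (j+1)) \<partial>\<sigma>)
          = (\<integral>t. 1 / (of_real t - ?z y) \<partial>\<sigma>) + (\<Sum>j\<le>2*k. (\<integral>t. of_real (t ^ j) / ?z y ^ (j+1) \<partial>\<sigma>))"
        using ints by (subst Bochner_Integration.integral_add)
          (auto intro!: intk that Bochner_Integration.integral_sum Bochner_Integration.integrable_sum simp del: of_real_power)
      also have "\<dots> = m (?z y) + (\<Sum>j\<le>2*k. of_real (s j) / ?z y ^ (j+1))"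
        using intp(2) m[OF that] by (simp del: of_real_power)
      finally show "r y = (\<integral>t. of_real t ^ (2*k+1) / (of_real t - ?z y) \<partial>\<sigma>)"
        unfolding geo[OF that] r_def by (simp del: of_real_power)
    qed
    have kern: "of_real t ^ (2*k+1) / (of_real t - ?z y)
        = Complex (t ^ (2*k+2) / (t\<^sup>2 + y\<^sup>2)) (y * t ^ (2*k+1) / (t\<^sup>2 + y\<^sup>2))" if "y > 0" for t y
    proof -
      have "of_real t ^ (2*k+1) / (of_real t - ?z y) = of_real (t ^ (2*k+1)) * (1 / (of_real t - ?z y))"
        by simp
      also have "\<dots> = Complex (t ^ (2*k+2) / (t\<^sup>2 + y\<^sup>2)) (y * t ^ (2*k+1) / (t\<^sup>2 + y\<^sup>2))"
        unfolding kernel[OF that] by (simp add: complex_eq_iff mult_ac)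
      finally show ?thesis .
    qed
    \<comment> \<open>The real part has a nonnegative integrand, as
      \<open>integral_truncation_limit\<close> demands; the imaginary part carries the odd power,
      whose sign changes.\<close>
    have ReJ: "integrable \<sigma> (\<lambda>t. t ^ (2*k+2) * y\<^sup>2 / (t\<^sup>2 + y\<^sup>2))"
      "(\<integral>t. t ^ (2*k+2) * y\<^sup>2 / (t\<^sup>2 + y\<^sup>2) \<partial>\<sigma>) = y\<^sup>2 * Re (r y)"
      and ImJ: "(\<integral>t. t ^ (2*k+1) * y\<^sup>2 / (t\<^sup>2 + y\<^sup>2) \<partial>\<sigma>) = y * Im (r y)" if "y > 0" for y
    proof -
      have 1: "t ^ (2*k+2) * y\<^sup>2 / (t\<^sup>2 + y\<^sup>2) = y\<^sup>2 * Re (of_real t ^ (2*k+1) / (of_real t - ?z y))" for t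
        unfolding kern[OF that] by simp
      show "integrable \<sigma> (\<lambda>t. t ^ (2*k+2) * y\<^sup>2 / (t\<^sup>2 + y\<^sup>2))"
        unfolding 1 by (intro integrable_mult_right integrable_Re intr that)
      show "(\<integral>t. t ^ (2*k+2) * y\<^sup>2 / (t\<^sup>2 + y\<^sup>2) \<partial>\<sigma>) = y\<^sup>2 * Re (r y)"
        unfolding 1 r[OF that] integral_mult_right_zero integral_Re[OF intr[OF that]] ..
      have 2: "t ^ (2*k+1) * y\<^sup>2 / (t\<^sup>2 + y\<^sup>2) = y * Im (of_real t ^ (2*k+1) / (of_real t - ?z y))" for t
        unfolding kern[OF that] by (simp add: power2_eq_square mult_ac)
      show "(\<integral>t. t ^ (2*k+1) * y\<^sup>2 / (t\<^sup>2 + y\<^sup>2) \<partial>\<sigma>) = y * Im (r y)"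
        unfolding 2 r[OF that] integral_mult_right_zero integral_Im[OF intr[OF that]] ..
    qed
    have seq: "(\<lambda>n. F (real (Suc n))) \<longlonglongrightarrow> c" if "(F \<longlongrightarrow> c) at_top" for F :: "real \<Rightarrow> real" and c
      using filterlim_compose[OF that filterlim_real_sequentially, THEN LIMSEQ_Suc] by (simp add: o_def)
    have "((\<lambda>y. y\<^sup>2 * Re (r y)) \<longlongrightarrow> s (2*k+2)) at_top"
    proof -
      have "((\<lambda>y. s (2*k+2) - Re (?z y ^ 2 * r y + ?z y * of_real (s (2*k+1)) + of_real (s (2*k+2))))
          \<longlongrightarrow> s (2*k+2) - Re 0) at_top"
        by (intro tendsto_intros lim)
      then show ?thesis
        by (simp add: power_mult_distrib)
    qed
    from seq[OF this] have lim2: "(\<lambda>n. \<integral>t. t ^ (2*k+2) * (real (Suc n))\<^sup>2 / (t\<^sup>2 + (real (Suc n))\<^sup>2) \<partial>\<sigma>) \<longlonglongrightarrow> s (2*k+2)"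
      by (subst ReJ(2)) (simp_all del: of_nat_Suc)
    have meas2: "(\<lambda>t. t ^ (2*k+2)) \<in> borel_measurable \<sigma>"
      by measurable
    have nonneg2: "t ^ (2*k+2) \<ge> 0" for t :: real
      by (rule zero_le_even_power) simp
    have trunc2: "integrable \<sigma> (\<lambda>t. t ^ (2*k+2) * (real (Suc n))\<^sup>2 / (t\<^sup>2 + (real (Suc n))\<^sup>2))" for n
      by (rule ReJ(1)) simp
    note int2 = integral_truncation_limit(1)[OF meas2 nonneg2 M_is_borel trunc2 lim2]
    note s2 = integral_truncation_limit(2)[OF meas2 nonneg2 M_is_borel trunc2 lim2]
    \<comment> \<open>The odd power is dominated by 1 + t^(2 k + 2), which is why the even moment is
      settled before the odd one.\<close>
    have int1: "integrable \<sigma> (\<lambda>t. t ^ (2*k+1))"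
    proof (rule Bochner_Integration.integrable_bound)
      show "integrable \<sigma> (\<lambda>t. 1 + t ^ (2*k+2))"
        using int2 by (intro Bochner_Integration.integrable_add) auto
      have "\<bar>t\<bar> ^ (2*k+1) \<le> 1 + \<bar>t\<bar> ^ (2*k+2)" for t :: real
      proof (cases "\<bar>t\<bar> \<le> 1")
        case True
        then show ?thesis
          using power_le_one[of "\<bar>t\<bar>" "2*k+1"] by (simp add: add_increasing2)
      next
        case False
        then show ?thesis
          using power_increasing[of "2*k+1" "2*k+2" "\<bar>t\<bar>"] by simp
      qed
      moreover have "norm (1 + t ^ (2*k+2)) = 1 + \<bar>t\<bar> ^ (2*k+2)" for t :: real
        by (simp add: power_even_abs add_nonneg_nonneg zero_le_even_power abs_of_nonneg del: power_Suc)
      ultimately show "AE t in \<sigma>. norm (t ^ (2*k+1)) \<le> norm (1 + t ^ (2*k+2))"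
        by (simp add: power_abs del: power_Suc)
    qed measurable
    have "((\<lambda>y. y * Im (r y)) \<longlongrightarrow> s (2*k+1)) at_top"
    proof -
      have "((\<lambda>y. s (2*k+1) - inverse y * Im (?z y ^ 2 * r y + ?z y * of_real (s (2*k+1)) + of_real (s (2*k+2))))
          \<longlongrightarrow> s (2*k+1) - 0 * Im 0) at_top"
        by (intro tendsto_intros lim tendsto_inverse_0_at_top filterlim_ident)
      moreover have "\<forall>\<^sub>F y in at_top. s (2*k+1) - inverse y *
          Im (?z y ^ 2 * r y + ?z y * of_real (s (2*k+1)) + of_real (s (2*k+2))) = y * Im (r y)"
        using eventually_gt_at_top[of "0::real"]
        by eventually_elim (simp add: power_mult_distrib field_simps power2_eq_square)
      ultimately show ?thesis
        by (simp add: tendsto_cong)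
    qed
    from seq[OF this] have lim1: "(\<lambda>n. \<integral>t. t ^ (2*k+1) * (real (Suc n))\<^sup>2 / (t\<^sup>2 + (real (Suc n))\<^sup>2) \<partial>\<sigma>) \<longlonglongrightarrow> s (2*k+1)"
      by (subst ImJ) (simp_all del: of_nat_Suc)
    \<comment> \<open>Because of the changing sign, dominated convergence replaces monotone
      convergence; comparison with \<open>lim1\<close> identifies the moment.\<close>
    have "(\<lambda>n. \<integral>t. t ^ (2*k+1) * (real (Suc n))\<^sup>2 / (t\<^sup>2 + (real (Suc n))\<^sup>2) \<partial>\<sigma>) \<longlonglongrightarrow> (\<integral>t. t ^ (2*k+1) \<partial>\<sigma>)"
    proof (rule integral_dominated_convergence[where w="\<lambda>t. \<bar>t ^ (2*k+1)\<bar>"])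
      show "AE t in \<sigma>. (\<lambda>n. t ^ (2*k+1) * (real (Suc n))\<^sup>2 / (t\<^sup>2 + (real (Suc n))\<^sup>2)) \<longlonglongrightarrow> t ^ (2*k+1)"
      proof (rule AE_I2)
        fix t :: real
        have "(\<lambda>n. t ^ (2*k+1) * (1 / (t\<^sup>2 * (1 / real (Suc n))\<^sup>2 + 1))) \<longlonglongrightarrow> t ^ (2*k+1) * (1 / (t\<^sup>2 * 0\<^sup>2 + 1))"
          by (intro tendsto_intros LIMSEQ_Suc[OF lim_1_over_n]) auto
        moreover have "t ^ (2*k+1) * (1 / (t\<^sup>2 * (1 / real (Suc n))\<^sup>2 + 1))
            = t ^ (2*k+1) * (real (Suc n))\<^sup>2 / (t\<^sup>2 + (real (Suc n))\<^sup>2)" for n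
          using posd[of "real (Suc n)" t] by (simp add: field_simps power2_eq_square del: of_nat_Suc power_Suc)
        ultimately show "(\<lambda>n. t ^ (2*k+1) * (real (Suc n))\<^sup>2 / (t\<^sup>2 + (real (Suc n))\<^sup>2)) \<longlonglongrightarrow> t ^ (2*k+1)"
          by simp
      qed
      show "AE t in \<sigma>. norm (t ^ (2*k+1) * (real (Suc n))\<^sup>2 / (t\<^sup>2 + (real (Suc n))\<^sup>2)) \<le> \<bar>t ^ (2*k+1)\<bar>" for n
      proof (rule AE_I2)
        fix t :: real
        have "(real (Suc n))\<^sup>2 / (t\<^sup>2 + (real (Suc n))\<^sup>2) \<le> 1"
          using posd[of "real (Suc n)" t] by (simp del: of_nat_Suc)
        then have "\<bar>t ^ (2*k+1)\<bar> * ((real (Suc n))\<^sup>2 / (t\<^sup>2 + (real (Suc n))\<^sup>2)) \<le> \<bar>t ^ (2*k+1)\<bar> * 1"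
          by (rule mult_left_mono) simp
        then show "norm (t ^ (2*k+1) * (real (Suc n))\<^sup>2 / (t\<^sup>2 + (real (Suc n))\<^sup>2)) \<le> \<bar>t ^ (2*k+1)\<bar>"
          by (simp add: abs_mult del: of_nat_Suc power_Suc)
      qed
    qed (use int1 in \<open>simp_all del: power_Suc of_nat_Suc\<close>)
    then have s1: "(\<integral>t. t ^ (2*k+1) \<partial>\<sigma>) = s (2*k+1)"
      using lim1 LIMSEQ_unique by blast
    have "j \<le> 2*k \<or> j = 2*k+1 \<or> j = 2*k+2" if "j \<le> 2 * Suc k" for j
      using that by presburger
    then show ?case
      unfolding has_moments_def using intp int1 s1 int2 s2 by blast
  qed
  then show ?thesis
    using has_moment_expansion_tendsto[OF exp] by (simp add: E_def)
qed

subsection \<open>Integral representation of Nevanlinna functions\<close>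

lemma norm_diff_cnj_sq: "(norm (v - cnj w))\<^sup>2 = (norm (v - w))\<^sup>2 + 4 * Im v * Im w"
  unfolding cmod_power2 by (simp add: power2_eq_square algebra_simps)

text \<open>The upper half plane consists of the points closer to w than to its mirror image; this
  translates between Cayley quotients of modulus below 1 and positive imaginary parts.\<close>

lemma norm_diff_less_norm_diff_cnj:
  assumes "Im w > 0"
  shows "norm (v - w) < norm (v - cnj w) \<longleftrightarrow> Im v > 0"
proof -
  have "norm (v - w) < norm (v - cnj w) \<longleftrightarrow> (norm (v - w))\<^sup>2 < (norm (v - cnj w))\<^sup>2"
    by (metis norm_ge_zero pos2 power_less_imp_less_base power_strict_mono)
  also have "\<dots> \<longleftrightarrow> Im v > 0"
    using assms by (simp add: norm_diff_cnj_sq zero_less_mult_iff)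
  finally show ?thesis .
qed

text \<open>Schwarz's lemma after two Cayley maps, one sending w to 0 and the other sending f w to
  0. Strict positivity of Im f puts the transformed values into the open disc.\<close>

lemma schwarz_pick_strict:
  assumes hol: "f holomorphic_on {z. Im z > 0}"
    and pos: "\<And>z. Im z > 0 \<Longrightarrow> Im (f z) > 0" and z: "Im z > 0" and w: "Im w > 0"
  shows "norm (f z - f w) * norm (z - cnj w) \<le> norm (z - w) * norm (f z - cnj (f w))"
proof -
  \<comment> \<open>Inverse of the Cayley map sending z to (z - w) / (z - cnj w).\<close>
  define \<phi> where "\<phi> \<zeta> = (w - cnj w * \<zeta>) / (1 - \<zeta>)" for \<zeta>
  define g where "g \<zeta> = (f (\<phi> \<zeta>) - f w) / (f (\<phi> \<zeta>) - cnj (f w))" for \<zeta>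
  have ww: "w - cnj w \<noteq> 0"
    using w by (auto simp: complex_eq_iff)
  have \<phi>: "Im (\<phi> \<zeta>) > 0" if "norm \<zeta> < 1" for \<zeta>
  proof -
    have 1: "1 - \<zeta> \<noteq> 0" using that by auto
    have "\<phi> \<zeta> - w = \<zeta> * (\<phi> \<zeta> - cnj w)" and d: "\<phi> \<zeta> - cnj w = (w - cnj w) / (1 - \<zeta>)"
      using 1 by (simp_all add: \<phi>_def field_simps)
    then have "norm (\<phi> \<zeta> - w) = norm \<zeta> * norm (\<phi> \<zeta> - cnj w)"
      by (metis norm_mult)
    moreover have "norm (\<phi> \<zeta> - cnj w) > 0"
      using ww 1 by (simp add: d)
    ultimately have "norm (\<phi> \<zeta> - w) < norm (\<phi> \<zeta> - cnj w)"
      using that by simp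
    then show ?thesis
      using norm_diff_less_norm_diff_cnj[OF w] by blast
  qed
  have ne: "v - cnj w \<noteq> 0" if "Im v > 0" "Im w > 0" for v w
    using that by (auto simp: complex_eq_iff)
  have "\<phi> holomorphic_on ball 0 1"
    unfolding \<phi>_def by (intro holomorphic_intros) auto
  then have "(f \<circ> \<phi>) holomorphic_on ball 0 1"
    by (rule holomorphic_on_compose_gen[OF _ hol]) (auto simp: \<phi>)
  then have "g holomorphic_on ball 0 1"
    unfolding g_def o_def using ne[OF pos[OF \<phi>] pos[OF w]] by (intro holomorphic_intros) auto
  moreover have "g 0 = 0"
    by (simp add: g_def \<phi>_def)
  moreover have "norm (g \<zeta>) < 1" if "norm \<zeta> < 1" for \<zeta>
    using norm_diff_less_norm_diff_cnj[OF pos[OF w], of "f (\<phi> \<zeta>)"] pos[OF \<phi>[OF that]] ne[OF pos[OF \<phi>[OF that]] pos[OF w]]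
    by (simp add: g_def norm_divide)
  ultimately have S: "norm (g \<zeta>) \<le> norm \<zeta>" if "norm \<zeta> < 1" for \<zeta>
    using that by (rule Schwarz_Lemma(1))
  define \<zeta> where "\<zeta> = (z - w) / (z - cnj w)"
  have nz: "norm (z - cnj w) > 0"
    using ne[OF z w] by simp
  have "norm \<zeta> < 1"
    using norm_diff_less_norm_diff_cnj[OF w, of z] z nz by (simp add: \<zeta>_def norm_divide)
  moreover have "\<phi> \<zeta> = z"
  proof -
    have "1 - \<zeta> = (w - cnj w) / (z - cnj w)" "w - cnj w * \<zeta> = z * (w - cnj w) / (z - cnj w)"
      using ne[OF z w] by (simp_all add: \<zeta>_def field_simps)
    then show ?thesis
      using ww ne[OF z w] by (simp add: \<phi>_def)
  qed
  ultimately have "norm ((f z - f w) / (f z - cnj (f w))) \<le> norm ((z - w) / (z - cnj w))"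
    using S[of \<zeta>] by (simp add: g_def \<zeta>_def)
  moreover have "norm (f z - cnj (f w)) > 0"
    using ne[OF pos[OF z] pos[OF w]] by simp
  ultimately show ?thesis
    using nz by (simp add: norm_divide field_simps)
qed

text \<open>Nevanlinna functions may take real values, so f is replaced by f + i \<delta> and
  \<delta> tends to 0. The form with products of imaginary parts is suited to letting w run to
  infinity.\<close>

lemma schwarz_pick_halfplane:
  assumes hol: "f holomorphic_on {z. Im z > 0}"
    and pos: "\<And>z. Im z > 0 \<Longrightarrow> Im (f z) \<ge> 0" and z: "Im z > 0" and w: "Im w > 0"
  shows "Im z * Im w * (norm (f z - cnj (f w)))\<^sup>2 \<le> Im (f z) * Im (f w) * (norm (z - cnj w))\<^sup>2"
proof -
  have ineq: "Im z * Im w * (norm (f z - cnj (f w) + 2 * \<i> * of_real \<delta>))\<^sup>2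
      \<le> (Im (f z) + \<delta>) * (Im (f w) + \<delta>) * (norm (z - cnj w))\<^sup>2" if "\<delta> > 0" for \<delta>
  proof -
    define g where "g v = f v + \<i> * of_real \<delta>" for v
    have "norm (g z - g w) * norm (z - cnj w) \<le> norm (z - w) * norm (g z - cnj (g w))"
      using pos that
      by (intro schwarz_pick_strict[OF _ _ z w]) (auto simp: g_def add_nonneg_pos intro!: holomorphic_intros hol)
    then have "(norm (g z - g w) * norm (z - cnj w))\<^sup>2 \<le> (norm (z - w) * norm (g z - cnj (g w)))\<^sup>2"
      by (intro power_mono) auto
    then have "(norm (g z - g w))\<^sup>2 * ((norm (z - w))\<^sup>2 + 4 * Im z * Im w)
        \<le> (norm (z - w))\<^sup>2 * ((norm (g z - g w))\<^sup>2 + 4 * Im (g z) * Im (g w))"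
      unfolding power_mult_distrib norm_diff_cnj_sq .
    \<comment> \<open>The product of the two squared norms cancels; after division by 4, four times
      the product of all imaginary parts is added to both sides.\<close>
    then have "Im z * Im w * ((norm (g z - g w))\<^sup>2 + 4 * Im (g z) * Im (g w))
        \<le> Im (g z) * Im (g w) * ((norm (z - w))\<^sup>2 + 4 * Im z * Im w)"
      by (simp add: algebra_simps)
    then have "Im z * Im w * (norm (g z - cnj (g w)))\<^sup>2 \<le> Im (g z) * Im (g w) * (norm (z - cnj w))\<^sup>2"
      unfolding norm_diff_cnj_sq .
    moreover have eq: "g z - cnj (g w) = f z - cnj (f w) + 2 * \<i> * of_real \<delta>"
      by (simp add: g_def)
    ultimately show ?thesis
      unfolding eq by (simp add: g_def)
  qed
  show ?thesis
  proof (rule tendsto_le[OF trivial_limit_at_right_real])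
    have "((\<lambda>\<delta>. (Im (f z) + \<delta>) * (Im (f w) + \<delta>) * (norm (z - cnj w))\<^sup>2)
        \<longlongrightarrow> (Im (f z) + 0) * (Im (f w) + 0) * (norm (z - cnj w))\<^sup>2) (at_right (0::real))"
      by (intro tendsto_intros)
    then show "((\<lambda>\<delta>. (Im (f z) + \<delta>) * (Im (f w) + \<delta>) * (norm (z - cnj w))\<^sup>2)
        \<longlongrightarrow> Im (f z) * Im (f w) * (norm (z - cnj w))\<^sup>2) (at_right (0::real))"
      by simp
    have "((\<lambda>\<delta>. Im z * Im w * (norm (f z - cnj (f w) + 2 * \<i> * of_real \<delta>))\<^sup>2)
        \<longlongrightarrow> Im z * Im w * (norm (f z - cnj (f w) + 2 * \<i> * of_real 0))\<^sup>2) (at_right (0::real))"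
      by (intro tendsto_intros)
    then show "((\<lambda>\<delta>. Im z * Im w * (norm (f z - cnj (f w) + 2 * \<i> * of_real \<delta>))\<^sup>2)
        \<longlongrightarrow> Im z * Im w * (norm (f z - cnj (f w)))\<^sup>2) (at_right (0::real))"
      by simp
    show "\<forall>\<^sub>F \<delta> in at_right 0. Im z * Im w * (norm (f z - cnj (f w) + 2 * \<i> * of_real \<delta>))\<^sup>2
        \<le> (Im (f z) + \<delta>) * (Im (f w) + \<delta>) * (norm (z - cnj w))\<^sup>2"
      using eventually_at_right_less[of "0::real"] by eventually_elim (rule ineq)
  qed
qed

section \<open>Growth of Nevanlinna functions\<close>

lemma nevanlinnaD:
  assumes "f \<in> nevanlinna"
  shows "f holomorphic_on {z. Im z > 0}" "Im z > 0 \<Longrightarrow> Im (f z) \<ge> 0"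
    "Im z < 0 \<Longrightarrow> f z = cnj (f (cnj z))"
  using assms by (auto simp: nevanlinna_def)

text \<open>In the Schwarz--Pick inequality with w = i y, divided by y, f(i y) tends to 0, y Im f(i
  y) tends to c, and the squared distance from z to cnj w grows like y^2.\<close>

lemma nevanlinna_norm_le:
  assumes f: "f \<in> nevanlinna"
    and lim: "((\<lambda>y. \<i> * of_real y * f (\<i> * of_real y)) \<longlongrightarrow> - of_real c) at_top" and z: "Im z > 0"
  shows "Im z * (norm (f z))\<^sup>2 \<le> c * Im (f z)"
proof -
  have f0: "((\<lambda>y. f (\<i> * of_real y)) \<longlongrightarrow> 0) at_top"
  proof (rule Lim_transform_eventually)
    show "((\<lambda>y. 1 / (\<i> * of_real y) * (\<i> * of_real y * f (\<i> * of_real y))) \<longlongrightarrow> 0) at_top"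
      using tendsto_mult[OF tendsto_inverse_imaginary lim] by simp
    show "\<forall>\<^sub>F y in at_top. 1 / (\<i> * of_real y) * (\<i> * of_real y * f (\<i> * of_real y)) = f (\<i> * of_real y)"
      using eventually_gt_at_top[of "0::real"] by eventually_elim simp
  qed
  have fy: "((\<lambda>y. y * Im (f (\<i> * of_real y))) \<longlongrightarrow> c) at_top"
    using tendsto_minus[OF tendsto_Re[OF lim]] by simp
  have zy: "((\<lambda>y. (norm (1 / (\<i> * of_real y) * z + 1))\<^sup>2) \<longlongrightarrow> (norm (0 * z + 1))\<^sup>2) at_top"
    by (intro tendsto_intros tendsto_inverse_imaginary)
  show ?thesis
  proof (rule tendsto_le[OF trivial_limit_at_top_linorder])
    have "((\<lambda>y. y * Im (f (\<i> * of_real y)) * Im (f z) * (norm (1 / (\<i> * of_real y) * z + 1))\<^sup>2)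
        \<longlongrightarrow> c * Im (f z) * (norm (0 * z + 1))\<^sup>2) at_top"
      by (intro tendsto_intros fy zy)
    then show "((\<lambda>y. y * Im (f (\<i> * of_real y)) * Im (f z) * (norm (1 / (\<i> * of_real y) * z + 1))\<^sup>2)
        \<longlongrightarrow> c * Im (f z)) at_top"
      by simp
    have "((\<lambda>y. Im z * (norm (f z - cnj (f (\<i> * of_real y))))\<^sup>2) \<longlongrightarrow> Im z * (norm (f z - cnj 0))\<^sup>2) at_top"
      by (intro tendsto_intros f0)
    then show "((\<lambda>y. Im z * (norm (f z - cnj (f (\<i> * of_real y))))\<^sup>2) \<longlongrightarrow> Im z * (norm (f z))\<^sup>2) at_top"
      by simp
    show "\<forall>\<^sub>F y in at_top. Im z * (norm (f z - cnj (f (\<i> * of_real y))))\<^sup>2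
        \<le> y * Im (f (\<i> * of_real y)) * Im (f z) * (norm (1 / (\<i> * of_real y) * z + 1))\<^sup>2"
      using eventually_gt_at_top[of "0::real"]
    proof eventually_elim
      case (elim y)
      have "z - cnj (\<i> * of_real y) = \<i> * of_real y * (1 / (\<i> * of_real y) * z + 1)"
        using elim by (simp add: field_simps)
      then have n: "(norm (z - cnj (\<i> * of_real y)))\<^sup>2 = y\<^sup>2 * (norm (1 / (\<i> * of_real y) * z + 1))\<^sup>2"
        by (simp only: norm_mult power_mult_distrib) simp
      have "Im z * y * (norm (f z - cnj (f (\<i> * of_real y))))\<^sup>2
          \<le> Im (f z) * Im (f (\<i> * of_real y)) * (y\<^sup>2 * (norm (1 / (\<i> * of_real y) * z + 1))\<^sup>2)"
        using schwarz_pick_halfplane[OF nevanlinnaD(1,2)[OF f] z, of "\<i> * of_real y"] elim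
        unfolding n by simp
      then have "y * (Im z * (norm (f z - cnj (f (\<i> * of_real y))))\<^sup>2)
          \<le> y * (y * Im (f (\<i> * of_real y)) * Im (f z) * (norm (1 / (\<i> * of_real y) * z + 1))\<^sup>2)"
        by (simp add: power2_eq_square mult_ac)
      then show ?case
        using elim by simp
    qed
  qed
qed

text \<open>Follows from Im (f z) \<le> norm (f z) after cancelling a factor norm (f z). If f z = 0
  nothing can be cancelled, and c \<ge> 0 is read off the limit of y Im f(i y).\<close>

lemma nevanlinna_norm_le':
  assumes "f \<in> nevanlinna"
    and "((\<lambda>y. \<i> * of_real y * f (\<i> * of_real y)) \<longlongrightarrow> - of_real c) at_top" and z: "Im z > 0"
  shows "norm (f z) \<le> c / Im z"
proof (cases "f z = 0")
  case True
  have "((\<lambda>y. y * Im (f (\<i> * of_real y))) \<longlongrightarrow> c) at_top"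
    using tendsto_minus[OF tendsto_Re[OF assms(2)]] by simp
  then have "c \<ge> 0"
    by (rule tendsto_lowerbound)
      (auto intro!: eventually_mono[OF eventually_gt_at_top[of 0]] mult_nonneg_nonneg nevanlinnaD(2)[OF assms(1)])
  then show ?thesis
    using True z by simp
next
  case False
  have le: "Im z * (norm (f z))\<^sup>2 \<le> c * Im (f z)"
    by (rule nevanlinna_norm_le[OF assms])
  then have "c * Im (f z) > 0"
    using False z by (smt (verit) mult_pos_pos norm_eq_zero zero_less_power norm_ge_zero)
  then have "c > 0"
    using nevanlinnaD(2)[OF assms(1) z] by (simp add: zero_less_mult_iff)
  then have "c * Im (f z) \<le> c * norm (f z)"
    using abs_Im_le_cmod[of "f z"] by (intro mult_left_mono) auto
  with le have "Im z * norm (f z) * norm (f z) \<le> c * norm (f z)"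
    by (simp add: power2_eq_square mult_ac)
  then have "Im z * norm (f z) \<le> c"
    using False by simp
  then show ?thesis
    using z by (simp add: field_simps)
qed

section \<open>Poisson's formula on the upper half plane\<close>

lemma poisson_kernel_integral:
  assumes "Im z > 0"
  shows "integrable lborel (\<lambda>t. 1 / (norm (of_real t - z))\<^sup>2)"
    "(\<integral>t. 1 / (norm (of_real t - z))\<^sup>2 \<partial>lborel) = pi / Im z"
proof -
  let ?g = "\<lambda>x::real. inverse (1 + x\<^sup>2)"
  have g: "integrable lborel ?g" "(\<integral>x. ?g x \<partial>lborel) = pi"
    using integrable_inverse_1_plus_square LBINT_inverse_1_plus_square
    by (simp_all add: set_integrable_def interval_lebesgue_integral_def set_lebesgue_integral_def)
  have eq: "1 / (norm (of_real t - z))\<^sup>2 = (1 / (Im z)\<^sup>2) * ?g (- (Re z / Im z) + (1 / Im z) * t)" for t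
  proof -
    have "(norm (of_real t - z))\<^sup>2 = (t - Re z)\<^sup>2 + (Im z)\<^sup>2"
      by (simp add: cmod_power2)
    also have "\<dots> = (Im z)\<^sup>2 * (1 + (- (Re z / Im z) + (1 / Im z) * t)\<^sup>2)"
      using assms by (simp add: field_simps power2_eq_square)
    finally show ?thesis
      by (simp add: divide_inverse)
  qed
  show "integrable lborel (\<lambda>t. 1 / (norm (of_real t - z))\<^sup>2)"
    unfolding eq using assms
    by (intro integrable_mult_right lborel_integrable_real_affine[where f="?g"] g) auto
  have "pi = (1 / Im z) * (\<integral>t. ?g (- (Re z / Im z) + (1 / Im z) * t) \<partial>lborel)"
    using lborel_integral_real_affine[of "1 / Im z" ?g "- (Re z / Im z)"] g assms by simp
  then show "(\<integral>t. 1 / (norm (of_real t - z))\<^sup>2 \<partial>lborel) = pi / Im z"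
    unfolding eq integral_mult_right_zero using assms by (simp add: field_simps power2_eq_square)
qed

text \<open>Subtracting \<open>h z\<close> removes the pole at \<open>z\<close>, so the integral of
  \<open>(h \<zeta> - h z) / ((\<zeta> - z) (\<zeta> - cnj z))\<close> over a half circle vanishes without a winding number computation.\<close>

lemma poisson_halfplane:
  assumes hol: "h holomorphic_on {z. Im z > - \<epsilon>}" and "\<epsilon> > 0"
    and bound: "\<And>z. Im z \<ge> 0 \<Longrightarrow> norm (h z) \<le> B" and z: "Im z > 0"
  shows "integrable lborel (\<lambda>t. Im (h (of_real t)) / (norm (of_real t - z))\<^sup>2)"
    "(\<integral>t. Im (h (of_real t)) / (norm (of_real t - z))\<^sup>2 \<partial>lborel) = pi / Im z * Im (h z)"
proof -
  \<comment> \<open>The margin below the real axis is cut off at Im z to keep \<open>cnj z\<close>,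
    the remaining pole of the quotient, outside \<open>S\<close>.\<close>
  define S where "S = {\<zeta>. Im \<zeta> > - min \<epsilon> (Im z)}"
  have S: "open S" "convex S"
    by (simp_all add: S_def open_halfspace_Im_gt convex_halfspace_Im_gt)
  define k where "k \<zeta> = (if \<zeta> = z then deriv h z else (h \<zeta> - h z) / (\<zeta> - z)) / (\<zeta> - cnj z)" for \<zeta>
  have "h holomorphic_on S"
    by (rule holomorphic_on_subset[OF hol]) (auto simp: S_def)
  then have "(\<lambda>\<zeta>. if \<zeta> = z then deriv h z else (h \<zeta> - h z) / (\<zeta> - z)) holomorphic_on S"
    using S(1) by (rule pole_lemma_open)
  then have holk: "k holomorphic_on S"
    unfolding k_def by (intro holomorphic_on_divide holomorphic_intros) (auto simp: S_def)
  have B: "norm (h z) \<le> B" "B \<ge> 0"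
    using bound[of z] z norm_ge_zero[of "h z"] by linarith+
  have normk: "norm (k \<zeta>) \<le> 2 * B / (norm (\<zeta> - z) * norm (\<zeta> - cnj z))"
    if "Im \<zeta> \<ge> 0" "\<zeta> \<noteq> z" for \<zeta>
  proof -
    have "norm (h \<zeta> - h z) \<le> 2 * B"
      using norm_triangle_ineq4[of "h \<zeta>" "h z"] bound[OF that(1)] B by linarith
    then show ?thesis
      using that by (simp add: k_def norm_divide norm_mult divide_right_mono)
  qed
  define K where "K t = k (of_real t)" for t
  have nz: "complex_of_real t \<noteq> z" for t
    using z by (auto simp: complex_eq_iff)
  have nsq: "(of_real t - z) * (of_real t - cnj z) = of_real ((norm (of_real t - z))\<^sup>2)" for t
    using complex_norm_square[of "of_real t - z"] by simp
  have Keq: "K t = (h (of_real t) - h z) / of_real ((norm (of_real t - z))\<^sup>2)" for t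
    using nz[of t] unfolding K_def k_def by (simp add: nsq del: of_real_power)
  have "continuous_on UNIV (k \<circ> complex_of_real)"
    by (intro continuous_on_compose continuous_intros)
      (auto intro!: continuous_on_subset[OF holomorphic_on_imp_continuous_on[OF holk]] simp: S_def assms)
  then have contK: "continuous_on UNIV K"
    by (simp add: K_def o_def)
  then have [measurable]: "K \<in> borel_measurable borel"
    by (rule borel_measurable_continuous_onI)
  have boundK: "norm (K t) \<le> 2 * B * (1 / (norm (of_real t - z))\<^sup>2)" for t
  proof -
    have "norm (of_real t - cnj z) = norm (of_real t - z)"
      by (metis complex_cnj_complex_of_real complex_cnj_diff complex_mod_cnj)
    then show ?thesis
      using normk[of "of_real t"] nz[of t] by (simp add: K_def power2_eq_square)
  qed
  have intK: "integrable lborel K"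
  proof (rule Bochner_Integration.integrable_bound)
    show "integrable lborel (\<lambda>t. 2 * B * (1 / (norm (of_real t - z))\<^sup>2))"
      by (intro integrable_mult_right poisson_kernel_integral z)
    show "AE t in lborel. norm (K t) \<le> norm (2 * B * (1 / (norm (of_real t - z))\<^sup>2))"
      using boundK B by (intro AE_I2) (auto intro: order_trans)
  qed simp
  \<comment> \<open>The segment is closed by a half circle of radius R, and Cauchy's theorem turns
    the truncated integral into one over the arc. The quotient decays like 1/R^2 while the arc has
    length pi R.\<close>
  have seg: "norm (\<integral>t. indicator {- R..R} t *\<^sub>R K t \<partial>lborel) \<le> 2 * B / (R - norm z)\<^sup>2 * R * pi"
    if R: "R > norm z" for R :: real
  proof -
    have R0: "R > 0" using R norm_ge_zero[of z] by linarith
    define \<gamma> where "\<gamma> = part_circlepath 0 R 0 pi"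
    define l where "l = linepath (of_real (- R)) (complex_of_real R)"
    have \<gamma>img: "path_image \<gamma> \<subseteq> {\<zeta>. norm \<zeta> = R \<and> Im \<zeta> \<ge> 0}"
      using R0 by (auto simp: \<gamma>_def path_image_part_circlepath norm_mult Im_exp sin_ge_zero)
    have limg: "path_image l \<subseteq> {\<zeta>. Im \<zeta> = 0}"
      by (auto simp: l_def closed_segment_def)
    have sub: "path_image \<gamma> \<subseteq> S" "path_image l \<subseteq> S"
      using \<gamma>img limg assms by (force simp: S_def)+
    have ends: "pathfinish \<gamma> = pathstart l" "pathfinish l = pathstart \<gamma>"
      using R0 by (simp_all add: \<gamma>_def l_def exp_pi_i')
    have vp: "valid_path \<gamma>" "valid_path l"
      by (simp_all add: \<gamma>_def l_def)
    have cauchy: "(k has_contour_integral 0) (\<gamma> +++ l)"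
      by (rule Cauchy_theorem_convex_simple[OF holk S(2)])
         (use sub ends vp in \<open>auto simp: path_image_join valid_path_join\<close>)
    have ci: "k contour_integrable_on \<gamma>" "k contour_integrable_on l"
      using S holk sub vp contour_integrable_holomorphic_simple by blast+
    have sum0: "contour_integral \<gamma> k + contour_integral l k = 0"
      using contour_integral_join[OF ci vp] contour_integral_unique[OF cauchy] by simp
    have "contour_integral l k = integral {- R..R} K"
      unfolding l_def K_def by (subst contour_integral_linepath_Reals_eq) (use R0 in auto)
    also have "\<dots> = (\<integral>t. indicator {- R..R} t *\<^sub>R K t \<partial>lborel)"
    proof -
      have "set_integrable lborel {- R..R} K"
        unfolding set_integrable_def using intK by (intro integrable_mult_indicator) auto
      then show ?thesis
        using set_borel_integral_eq_integral(2)[of "{- R..R}" K] by (simp add: set_lebesgue_integral_def)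
    qed
    finally have "norm (\<integral>t. indicator {- R..R} t *\<^sub>R K t \<partial>lborel) = norm (contour_integral \<gamma> k)"
      using sum0 by (metis add_eq_0_iff norm_minus_cancel)
    also have "\<dots> \<le> 2 * B / (R - norm z)\<^sup>2 * R * \<bar>pi - 0\<bar>"
      unfolding \<gamma>_def
    proof (rule contour_integral_bound_part_circlepath)
      fix \<zeta> assume "\<zeta> \<in> path_image (part_circlepath 0 R 0 pi)"
      then have \<zeta>: "norm \<zeta> = R" "Im \<zeta> \<ge> 0"
        using \<gamma>img by (auto simp: \<gamma>_def)
      have d: "norm (\<zeta> - z) \<ge> R - norm z" "norm (\<zeta> - cnj z) \<ge> R - norm z"
        using norm_triangle_ineq2[of \<zeta> z] norm_triangle_ineq2[of \<zeta> "cnj z"] \<zeta> by auto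
      then have "\<zeta> \<noteq> z" using R by auto
      then have "norm (k \<zeta>) \<le> 2 * B / (norm (\<zeta> - z) * norm (\<zeta> - cnj z))"
        using normk \<zeta> by blast
      also have "\<dots> \<le> 2 * B / ((R - norm z) * (R - norm z))"
        using d R B by (intro divide_left_mono mult_mono mult_pos_pos) auto
      finally show "norm (k \<zeta>) \<le> 2 * B / (R - norm z)\<^sup>2"
        by (simp add: power2_eq_square)
    qed (use ci R0 B in \<open>auto simp: \<gamma>_def\<close>)
    finally show ?thesis by simp
  qed
  have "(\<lambda>n::nat. \<integral>t. indicator {- real n..real n} t *\<^sub>R K t \<partial>lborel) \<longlonglongrightarrow> (\<integral>t. K t \<partial>lborel)"
  proof (rule integral_dominated_convergence[where w="\<lambda>t. norm (K t)"])
    show "AE t in lborel. (\<lambda>n::nat. indicator {- real n..real n} t *\<^sub>R K t) \<longlonglongrightarrow> K t"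
    proof (rule AE_I2, rule tendsto_eventually)
      fix t :: real
      obtain N where "\<bar>t\<bar> \<le> real N" using real_arch_simple by blast
      then show "\<forall>\<^sub>F n in sequentially. indicator {- real n..real n} t *\<^sub>R K t = K t"
        unfolding eventually_sequentially by (intro exI[of _ N]) (auto simp: indicator_def)
    qed
    show "AE t in lborel. norm (indicator {- real n..real n} t *\<^sub>R K t) \<le> norm (K t)" for n :: nat
      by (intro AE_I2) (auto simp: indicator_def)
  qed (use intK in auto)
  moreover have "(\<lambda>n::nat. \<integral>t. indicator {- real n..real n} t *\<^sub>R K t \<partial>lborel) \<longlonglongrightarrow> 0"
  proof (rule Lim_null_comparison)
    show "\<forall>\<^sub>F n in sequentially. norm (\<integral>t. indicator {- real n..real n} t *\<^sub>R K t \<partial>lborel)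
        \<le> 2 * B / (real n - norm z)\<^sup>2 * real n * pi"
      using eventually_gt_at_top[of "nat \<lceil>norm z\<rceil>"] by eventually_elim (rule seg, linarith)
    show "(\<lambda>n. 2 * B / (real n - norm z)\<^sup>2 * real n * pi) \<longlonglongrightarrow> 0"
      by real_asymp
  qed
  ultimately have K0: "(\<integral>t. K t \<partial>lborel) = 0"
    using LIMSEQ_unique by blast
  \<comment> \<open>On the real line \<open>K\<close> is h - h z over the squared distance to z, so
    the vanishing of its integral leaves \<open>Im (h z)\<close> times the integral of the
    kernel.\<close>
  have Im: "Im (h (of_real t)) / (norm (of_real t - z))\<^sup>2 = Im (K t) + Im (h z) * (1 / (norm (of_real t - z))\<^sup>2)" for t
    unfolding Keq by (simp add: diff_divide_distrib)
  show "integrable lborel (\<lambda>t. Im (h (of_real t)) / (norm (of_real t - z))\<^sup>2)"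
    unfolding Im by (intro Bochner_Integration.integrable_add integrable_mult_right
        poisson_kernel_integral z integrable_Im intK)
  have kern: "integrable lborel (\<lambda>t. Im (h z) * (1 / (norm (of_real t - z))\<^sup>2))"
    by (intro integrable_mult_right poisson_kernel_integral z)
  have "(\<integral>t. Im (K t) + Im (h z) * (1 / (norm (of_real t - z))\<^sup>2) \<partial>lborel)
      = Im (\<integral>t. K t \<partial>lborel) + Im (h z) * (\<integral>t. 1 / (norm (of_real t - z))\<^sup>2 \<partial>lborel)"
    by (simp only: Bochner_Integration.integral_add[OF integrable_Im[OF intK] kern] integral_Im[OF intK]
        integral_mult_right_zero)
  then show "(\<integral>t. Im (h (of_real t)) / (norm (of_real t - z))\<^sup>2 \<partial>lborel) = pi / Im z * Im (h z)"
    unfolding Im K0 poisson_kernel_integral(2)[OF z] by simp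
qed

section \<open>Cauchy transforms of finite measures\<close>

lemma (in finite_measure) norm_integral_le:
  fixes f :: "'a \<Rightarrow> 'b::{banach, second_countable_topology}"
  assumes "integrable M f" "\<And>x. norm (f x) \<le> c"
  shows "norm (\<integral>x. f x \<partial>M) \<le> c * measure M (space M)"
proof -
  have "norm (\<integral>x. f x \<partial>M) \<le> (\<integral>x. norm (f x) \<partial>M)"
    by (rule integral_norm_bound)
  also have "\<dots> \<le> (\<integral>x. c \<partial>M)"
    using assms by (intro integral_mono) auto
  finally show ?thesis
    by (simp add: mult.commute)
qed

lemma norm_cauchy_kernel_le:
  assumes "Im z \<noteq> 0"
  shows "norm (1 / (of_real t - z)) \<le> 1 / \<bar>Im z\<bar>"
  using assms abs_Im_le_cmod[of "of_real t - z"] by (simp add: norm_divide frac_le)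

context finite_borel_measure
begin

lemma integrable_cauchy_kernel:
  assumes "Im z \<noteq> 0"
  shows "integrable M (\<lambda>t. 1 / (of_real t - z))"
proof (rule integrable_const_bound[where B="1 / \<bar>Im z\<bar>"])
  show "AE t in M. norm (1 / (of_real t - z)) \<le> 1 / \<bar>Im z\<bar>"
    using norm_cauchy_kernel_le[OF assms] by simp
  have [measurable_cong]: "sets M = sets borel"
    by (rule M_is_borel)
  show "(\<lambda>t. 1 / (of_real t - z)) \<in> borel_measurable M"
    by measurable
qed

lemma Im_cauchy_transform:
  assumes "Im z \<noteq> 0"
  shows "Im (\<integral>t. 1 / (of_real t - z) \<partial>M) = Im z * (\<integral>t. 1 / (norm (of_real t - z))\<^sup>2 \<partial>M)"
proof -
  have "Im (1 / (of_real t - z)) = Im z * (1 / (norm (of_real t - z))\<^sup>2)" for t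
    by (simp add: Im_divide cmod_power2)
  then show ?thesis
    unfolding integral_Im[OF integrable_cauchy_kernel[OF assms], symmetric]
    by (simp only: integral_mult_right_zero)
qed

text \<open>Differentiation under the integral by a direct estimate: the error of the difference
  quotient has the kernel (w - z) / ((t - w) (t - z)^2), bounded by (2/y)^3 norm (w - z) for w
  within y/2 of z, where y = Im z.\<close>

lemma holomorphic_cauchy_transform:
  "(\<lambda>z. \<integral>t. 1 / (of_real t - z) \<partial>M) holomorphic_on {z. Im z > 0}"
proof -
  let ?F = "\<lambda>z. \<integral>t. 1 / (of_real t - z) \<partial>M"
  have [measurable_cong]: "sets M = sets borel"
    by (rule M_is_borel)
  have "(?F has_field_derivative (\<integral>t. 1 / (of_real t - z)\<^sup>2 \<partial>M)) (at z)" if z: "Im z > 0" for z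
  proof -
    define y where "y = Im z"
    have y: "y > 0" using z by (simp add: y_def)
    have bd: "norm (1 / (of_real t - w)) \<le> 2 / y" "of_real t - w \<noteq> 0" "Im w > 0" if "norm (w - z) < y / 2" for t w
    proof -
      have "\<bar>Im (w - z)\<bar> < y / 2"
        using abs_Im_le_cmod[of "w - z"] that by linarith
      then have w: "Im w > y / 2"
        using abs_ge_minus_self[of "Im (w - z)"] unfolding y_def minus_complex.sel by linarith
      then show "Im w > 0" "of_real t - w \<noteq> 0"
        using y by auto
      have "norm (1 / (of_real t - w)) \<le> 1 / \<bar>Im w\<bar>"
        using w y by (intro norm_cauchy_kernel_le) auto
      also have "\<dots> \<le> 1 / (y / 2)"
        using w y by (intro divide_left_mono) auto
      finally show "norm (1 / (of_real t - w)) \<le> 2 / y"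
        by simp
    qed
    have z0: "norm (z - z) < y / 2"
      using y by simp
    have int2: "integrable M (\<lambda>t. 1 / (of_real t - z)\<^sup>2)"
    proof (rule integrable_const_bound[where B="(2 / y)\<^sup>2"])
      have "norm (1 / (of_real t - z)\<^sup>2) \<le> (2 / y)\<^sup>2" for t
        using power_mono[OF bd(1)[OF z0, of t], of 2] by (simp add: norm_divide norm_power power_divide)
      then show "AE t in M. norm (1 / (of_real t - z)\<^sup>2) \<le> (2 / y)\<^sup>2"
        by simp
    qed measurable
    have est: "norm ((?F w - ?F z) / (w - z) - (\<integral>t. 1 / (of_real t - z)\<^sup>2 \<partial>M))
        \<le> (norm (w - z) * (2 / y) ^ 3) * measure M (space M)"
      if w: "norm (w - z) < y / 2" "w \<noteq> z" for w
    proof -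
      have int: "integrable M (\<lambda>t. (1 / (of_real t - w) - 1 / (of_real t - z)) / (w - z) - 1 / (of_real t - z)\<^sup>2)"
        using bd(3)[OF w(1)] z
        by (intro Bochner_Integration.integrable_diff integrable_divide integrable_cauchy_kernel int2) auto
      have "(?F w - ?F z) / (w - z) - (\<integral>t. 1 / (of_real t - z)\<^sup>2 \<partial>M)
          = (\<integral>t. (1 / (of_real t - w) - 1 / (of_real t - z)) / (w - z) - 1 / (of_real t - z)\<^sup>2 \<partial>M)"
        using bd(3)[OF w(1)] z
        by (subst Bochner_Integration.integral_diff)
          (auto intro!: Bochner_Integration.integrable_diff integrable_divide integrable_cauchy_kernel int2
            simp: Bochner_Integration.integral_diff integrable_cauchy_kernel)
      also have "norm \<dots> \<le> (norm (w - z) * (2 / y) ^ 3) * measure M (space M)"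
      proof (rule norm_integral_le[OF int])
        fix t
        have "(1 / (of_real t - w) - 1 / (of_real t - z)) / (w - z) - 1 / (of_real t - z)\<^sup>2
            = (w - z) * ((1 / (of_real t - w)) * (1 / (of_real t - z)) * (1 / (of_real t - z)))"
          using bd(2)[OF w(1), of t] bd(2)[OF z0, of t] w(2)
          by (simp add: divide_simps power2_eq_square)
        also have "norm \<dots> \<le> norm (w - z) * ((2 / y) * (2 / y) * (2 / y))"
          unfolding norm_mult
          by (intro mult_mono bd(1) w z0 order_refl mult_nonneg_nonneg norm_ge_zero) (use y in auto)
        finally show "norm ((1 / (of_real t - w) - 1 / (of_real t - z)) / (w - z) - 1 / (of_real t - z)\<^sup>2)
            \<le> norm (w - z) * (2 / y) ^ 3"
          by (simp add: power3_eq_cube)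
      qed
      finally show ?thesis .
    qed
    have "((\<lambda>w. (?F w - ?F z) / (w - z) - (\<integral>t. 1 / (of_real t - z)\<^sup>2 \<partial>M)) \<longlongrightarrow> 0) (at z)"
    proof (rule Lim_null_comparison)
      show "\<forall>\<^sub>F w in at z. norm ((?F w - ?F z) / (w - z) - (\<integral>t. 1 / (of_real t - z)\<^sup>2 \<partial>M))
          \<le> (norm (w - z) * (2 / y) ^ 3) * measure M (space M)"
        unfolding eventually_at using est y by (intro exI[of _ "y / 2"]) (auto simp: dist_norm)
      have "((\<lambda>w. (norm (w - z) * (2 / y) ^ 3) * measure M (space M))
          \<longlongrightarrow> (norm (z - z) * (2 / y) ^ 3) * measure M (space M)) (at z)"
        by (intro tendsto_intros)
      then show "((\<lambda>w. (norm (w - z) * (2 / y) ^ 3) * measure M (space M)) \<longlongrightarrow> 0) (at z)"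
        by simp
    qed
    then show ?thesis
      unfolding has_field_derivative_iff by (simp add: LIM_zero_iff)
  qed
  then show ?thesis
    using holomorphic_on_open[OF open_halfspace_Im_gt] by blast
qed

end

text \<open>By the open mapping theorem the image under a nonconstant g would contain a ball, but it
  lies on the real line.\<close>

lemma holomorphic_Im_zero_constant:
  assumes hol: "g holomorphic_on S" and S: "open S" "connected S"
    and Im: "\<And>z. z \<in> S \<Longrightarrow> Im (g z) = 0"
  shows "g constant_on S"
proof (rule ccontr)
  assume nc: "\<not> g constant_on S"
  then have "open (g ` S)"
    by (rule open_mapping_thm[OF hol S S(1) order_refl])
  moreover obtain a where "a \<in> S"
    using nc by (auto simp: constant_on_def)
  ultimately obtain e where e: "e > 0" "ball (g a) e \<subseteq> g ` S"
    by (meson imageI open_contains_ball)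
  have "g a + \<i> * of_real (e / 2) \<in> ball (g a) e"
    using e(1) by (simp add: dist_norm norm_mult)
  then obtain b where "b \<in> S" "g b = g a + \<i> * of_real (e / 2)"
    using e(2) by (metis imageE subsetD)
  then have "Im (g a + \<i> * of_real (e / 2)) = 0"
    using Im by metis
  then show False
    using Im[OF \<open>a \<in> S\<close>] e(1) by simp
qed

text \<open>For c > 0 the functions Im f(t + i \<epsilon>) / (pi c) are probability densities;
  tightness yields a weak limit M, and c M is the measure sought. Poisson kernels only see Im f, so
  f and the Cauchy transform agree up to a constant, which is zero because both are O(1/y) along the
  imaginary axis.\<close>

theorem nevanlinna_representation:
  assumes f: "f \<in> nevanlinna"
    and lim: "((\<lambda>y. \<i> * of_real y * f (\<i> * of_real y)) \<longlongrightarrow> - of_real c) at_top"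
  shows "\<exists>\<sigma>. represents \<sigma> f"
proof (cases "c > 0")
  case False
  \<comment> \<open>Without c > 0 no normalisation is possible, but the bound
    \<open>nevanlinna_norm_le\<close> forces f = 0, which the zero measure represents.\<close>
  have H: "f z = 0" if "Im z > 0" for z
  proof -
    have "Im z * (norm (f z))\<^sup>2 \<le> c * Im (f z)"
      by (rule nevanlinna_norm_le[OF f lim that])
    also have "\<dots> \<le> 0"
      using False nevanlinnaD(2)[OF f that] by (simp add: mult_nonpos_nonneg)
    finally show ?thesis
      using that by (simp add: mult_le_0_iff)
  qed
  have L: "f z = 0" if "Im z < 0" for z
    by (subst nevanlinnaD(3)[OF f that]) (use H[of "cnj z"] that in simp)
  have "represents (null_measure borel) f"
    unfolding represents_def
  proof (intro conjI allI impI)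
    show "finite_borel_measure (null_measure borel :: real measure)"
      by (intro finite_borel_measure.intro finite_measureI finite_borel_measure_axioms.intro) simp_all
    show "f z = (\<integral>t. 1 / (of_real t - z) \<partial>null_measure borel)" if "Im z \<noteq> 0" for z
      using H[of z] L[of z] that by (cases "Im z > 0") auto
  qed
  then show ?thesis ..
next
  case True
  define \<epsilon> where "\<epsilon> n = 1 / real (Suc n)" for n
  have \<epsilon>: "\<epsilon> n > 0" "\<epsilon> n \<le> 1" for n
    by (simp_all add: \<epsilon>_def)
  define g where "g n t = Im (f (of_real t + \<i> * of_real (\<epsilon> n))) / (pi * c)" for n t
  have g0: "g n t \<ge> 0" for n t
    unfolding g_def using True \<epsilon>(1)[of n] by (intro divide_nonneg_pos nevanlinnaD(2)[OF f]) auto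
  have contf: "continuous_on {z. Im z > 0} f"
    using nevanlinnaD(1)[OF f] by (rule holomorphic_on_imp_continuous_on)
  have "continuous_on UNIV (g n)" for n
    unfolding g_def using True
    by (intro continuous_intros continuous_on_compose2[OF contf]) (auto simp: \<epsilon>)
  then have g_meas [measurable]: "g n \<in> borel_measurable borel" for n
    by (rule borel_measurable_continuous_onI)
  have poisson: "integrable lborel (\<lambda>t. g n t / (norm (of_real t - z))\<^sup>2)"
      "(\<integral>t. g n t / (norm (of_real t - z))\<^sup>2 \<partial>lborel) = Im (f (z + \<i> * of_real (\<epsilon> n))) / (c * Im z)"
    if z: "Im z > 0" for n z
  proof -
    \<comment> \<open>The line at height \<open>\<epsilon> n\<close> is the real axis for the
      shifted function, which is holomorphic across it and bounded by
      \<open>c / \<epsilon> n\<close>.\<close>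
    define h where "h z = f (z + \<i> * of_real (\<epsilon> n))" for z
    have "(f \<circ> (\<lambda>z. z + \<i> * of_real (\<epsilon> n))) holomorphic_on {z. Im z > - \<epsilon> n}"
      by (intro holomorphic_on_compose_gen[OF _ nevanlinnaD(1)[OF f]] holomorphic_intros) auto
    then have hol: "h holomorphic_on {z. Im z > - \<epsilon> n}"
      by (simp add: h_def[abs_def] o_def)
    have bound: "norm (h z) \<le> c / \<epsilon> n" if "Im z \<ge> 0" for z
    proof -
      have "norm (h z) \<le> c / Im (z + \<i> * of_real (\<epsilon> n))"
        unfolding h_def using that \<epsilon>(1)[of n] by (intro nevanlinna_norm_le'[OF f lim]) auto
      also have "\<dots> \<le> c / \<epsilon> n"
        using that \<epsilon>(1)[of n] True by (intro divide_left_mono) auto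
      finally show ?thesis .
    qed
    note P = poisson_halfplane[OF hol \<epsilon>(1) bound z]
    have eq: "g n t / (norm (of_real t - z))\<^sup>2 = 1 / (pi * c) * (Im (h (of_real t)) / (norm (of_real t - z))\<^sup>2)" for t
      by (simp add: g_def h_def)
    show "integrable lborel (\<lambda>t. g n t / (norm (of_real t - z))\<^sup>2)"
      unfolding eq by (intro integrable_mult_right P(1))
    show "(\<integral>t. g n t / (norm (of_real t - z))\<^sup>2 \<partial>lborel) = Im (f (z + \<i> * of_real (\<epsilon> n))) / (c * Im z)"
    proof -
      have "(\<integral>t. g n t / (norm (of_real t - z))\<^sup>2 \<partial>lborel) = 1 / (pi * c) * (pi / Im z * Im (h z))"
        unfolding eq integral_mult_right_zero by (simp only: P(2))
      then show ?thesis
        using True z by (simp add: h_def)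
    qed
  qed
  \<comment> \<open>Poisson's formula at z = i y expresses the truncated masses of
    \<open>g n\<close> by values of \<open>\<phi>\<close>; its limit 1 gives both total mass 1 and
    tightness.\<close>
  define \<phi> where "\<phi> y = y * Im (f (\<i> * of_real y)) / c" for y
  have \<phi>lim: "(\<phi> \<longlongrightarrow> 1) at_top"
  proof -
    have "((\<lambda>y. - Re (\<i> * of_real y * f (\<i> * of_real y)) / c) \<longlongrightarrow> - Re (- of_real c) / c) at_top"
      using True by (intro tendsto_intros lim) auto
    then show ?thesis
      using True by (simp add: \<phi>_def[abs_def])
  qed
  have trunc: "integrable lborel (\<lambda>t. g n t * y\<^sup>2 / (t\<^sup>2 + y\<^sup>2))"
      "(\<integral>t. g n t * y\<^sup>2 / (t\<^sup>2 + y\<^sup>2) \<partial>lborel) = y / (y + \<epsilon> n) * \<phi> (y + \<epsilon> n)"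
    if y: "y > 0" for n y
  proof -
    have z: "Im (\<i> * of_real y) > 0" using y by simp
    have eq: "g n t * y\<^sup>2 / (t\<^sup>2 + y\<^sup>2) = y\<^sup>2 * (g n t / (norm (of_real t - \<i> * of_real y))\<^sup>2)" for t
      by (simp add: cmod_power2)
    show "integrable lborel (\<lambda>t. g n t * y\<^sup>2 / (t\<^sup>2 + y\<^sup>2))"
      unfolding eq by (intro integrable_mult_right poisson z)
    have "y + \<epsilon> n > 0" using y \<epsilon>(1)[of n] by simp
    then show "(\<integral>t. g n t * y\<^sup>2 / (t\<^sup>2 + y\<^sup>2) \<partial>lborel) = y / (y + \<epsilon> n) * \<phi> (y + \<epsilon> n)"
      unfolding eq integral_mult_right_zero poisson(2)[OF z] using y
      by (simp add: \<phi>_def power2_eq_square distrib_left)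
  qed
  have mass: "integrable lborel (g n)" "(\<integral>t. g n t \<partial>lborel) = 1" for n
  proof -
    have "filterlim (\<lambda>k. real (Suc k) + \<epsilon> n) at_top sequentially"
      by real_asymp
    from filterlim_compose[OF \<phi>lim this]
    have "(\<lambda>k. \<phi> (real (Suc k) + \<epsilon> n)) \<longlonglongrightarrow> 1" .
    moreover have "(\<lambda>k. real (Suc k) / (real (Suc k) + \<epsilon> n)) \<longlonglongrightarrow> 1"
      by real_asymp
    ultimately have "(\<lambda>k. real (Suc k) / (real (Suc k) + \<epsilon> n) * \<phi> (real (Suc k) + \<epsilon> n)) \<longlonglongrightarrow> 1 * 1"
      by (intro tendsto_mult)
    then have "(\<lambda>k. \<integral>t. g n t * (real (Suc k))\<^sup>2 / (t\<^sup>2 + (real (Suc k))\<^sup>2) \<partial>lborel) \<longlonglongrightarrow> 1"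
      by (subst trunc(2)) (simp_all del: of_nat_Suc)
    note L = integral_truncation_limit[OF _ g0 sets_lborel trunc(1) this]
    show "integrable lborel (g n)" "(\<integral>t. g n t \<partial>lborel) = 1"
      by (rule L; simp)+
  qed
  define \<mu> where "\<mu> n = density lborel (\<lambda>t. ennreal (g n t))" for n
  have int\<mu>: "(\<integral>t. F t \<partial>\<mu> n) = (\<integral>t. g n t * F t \<partial>lborel)" if "F \<in> borel_measurable borel" for n and F :: "real \<Rightarrow> real"
    unfolding \<mu>_def using that g0 by (subst integral_density) auto
  have dist\<mu>: "real_distribution (\<mu> n)" for n
  proof -
    have "emeasure (\<mu> n) (space (\<mu> n)) = 1"
      using nn_integral_eq_integral[OF mass(1)[of n]] g0[of n] mass(2)[of n]
      by (simp add: \<mu>_def emeasure_density)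
    then show ?thesis
      by (intro real_distribution.intro prob_spaceI real_distribution_axioms.intro) (simp_all add: \<mu>_def)
  qed
  have "tight \<mu>"
    unfolding tight_def
  proof (intro conjI allI impI dist\<mu>)
    fix \<eta> :: real assume "\<eta> > 0"
    \<comment> \<open>Chosen so that 2 (1 - \<delta>)^2 - 1 \<ge> 1 - 4 \<delta> \<ge> 1 - \<eta>;
      the bound 1/4 keeps 1 - \<delta> positive.\<close>
    define \<delta> where "\<delta> = min (\<eta> / 4) (1 / 4)"
    have \<delta>: "\<delta> > 0" "\<delta> \<le> \<eta> / 4" "\<delta> \<le> 1 / 4"
      using \<open>\<eta> > 0\<close> by (auto simp: \<delta>_def)
    \<comment> \<open>As \<open>\<epsilon> n\<close> \<le> 1 for all n, y / (y + 1) is a lower bound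
      of \<open>y / (y + \<epsilon> n)\<close>, and \<open>Y\<close> can be chosen independently of
      n.\<close>
    have "((\<lambda>y::real. y / (y + 1)) \<longlongrightarrow> 1) at_top"
      by real_asymp
    then have "\<forall>\<^sub>F y in at_top. (y::real) / (y + 1) > 1 - \<delta>" "\<forall>\<^sub>F y in at_top. \<phi> y > 1 - \<delta>"
      using \<delta> by (auto intro!: order_tendstoD(1)[where y=1] \<phi>lim)
    then have "\<forall>\<^sub>F y::real in at_top. y / (y + 1) > 1 - \<delta> \<and> \<phi> y > 1 - \<delta> \<and> y > 0"
      using eventually_gt_at_top[of "0::real"] by eventually_elim auto
    then obtain Y where "\<And>y. y \<ge> Y \<Longrightarrow> y / (y + 1) > 1 - \<delta> \<and> \<phi> y > 1 - \<delta> \<and> y > 0"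
      unfolding eventually_at_top_linorder by blast
    then have Y: "Y > 0" "Y / (Y + 1) > 1 - \<delta>" "\<And>y. y \<ge> Y \<Longrightarrow> \<phi> y > 1 - \<delta>"
      by auto
    have "measure (\<mu> n) {- Y<..Y} > 1 - \<eta>" for n
    proof -
      interpret real_distribution "\<mu> n" by (rule dist\<mu>)
      have "(1 - \<delta>) * (1 - \<delta>) < Y / (Y + \<epsilon> n) * \<phi> (Y + \<epsilon> n)"
      proof (rule mult_strict_mono)
        have "Y / (Y + 1) \<le> Y / (Y + \<epsilon> n)"
          using Y(1) \<epsilon>[of n] by (intro divide_left_mono) auto
        then show "1 - \<delta> < Y / (Y + \<epsilon> n)"
          using Y(2) by linarith
        show "1 - \<delta> < \<phi> (Y + \<epsilon> n)"
          using \<epsilon>(1)[of n] by (intro Y(3)) simp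
      qed (use Y(1) \<epsilon>(1)[of n] \<delta> in auto)
      also have "\<dots> = (\<integral>t. g n t * (Y\<^sup>2 / (t\<^sup>2 + Y\<^sup>2)) \<partial>lborel)"
        using trunc(2)[OF Y(1), of n] by simp
      also have "\<dots> = (\<integral>t. Y\<^sup>2 / (t\<^sup>2 + Y\<^sup>2) \<partial>\<mu> n)"
        by (rule int\<mu>[symmetric]) measurable
      \<comment> \<open>The kernel is at most 1 everywhere and at most 1/2 outside the interval, so
        a truncated mass near 1 forces the interval to carry almost all of the mass.\<close>
      also have "\<dots> \<le> (\<integral>t. 1 / 2 + 1 / 2 * indicator {- Y<..Y} t \<partial>\<mu> n)"
      proof (rule integral_mono)
        have pos: "t\<^sup>2 + Y\<^sup>2 > 0" for t
          using Y(1) by (simp add: add_nonneg_pos)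
        have le1: "Y\<^sup>2 / (t\<^sup>2 + Y\<^sup>2) \<le> 1" for t
          using pos[of t] by simp
        show "integrable (\<mu> n) (\<lambda>t. Y\<^sup>2 / (t\<^sup>2 + Y\<^sup>2))"
          by (rule integrable_const_bound[where B=1]) (auto intro!: AE_I2 le1 simp: abs_of_nonneg)
        show "integrable (\<mu> n) (\<lambda>t. 1 / 2 + 1 / 2 * indicator {- Y<..Y} t :: real)"
          by (intro Bochner_Integration.integrable_add integrable_mult_right) (auto simp: less_top[symmetric])
        fix t :: real
        show "Y\<^sup>2 / (t\<^sup>2 + Y\<^sup>2) \<le> 1 / 2 + 1 / 2 * indicator {- Y<..Y} t"
        proof (cases "t \<in> {- Y<..Y}")
          case True
          then show ?thesis using le1[of t] by simp
        next
          case False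
          then have "Y \<le> \<bar>t\<bar>" by auto
          then have "Y\<^sup>2 \<le> t\<^sup>2"
            using Y(1) by (metis abs_le_square_iff abs_of_pos)
          then show ?thesis
            using False pos[of t] by (simp add: field_simps)
        qed
      qed
      also have "\<dots> = 1 / 2 + 1 / 2 * measure (\<mu> n) {- Y<..Y}"
        by (subst Bochner_Integration.integral_add) (use prob_space in \<open>auto simp: less_top[symmetric]\<close>)
      finally have "measure (\<mu> n) {- Y<..Y} > 2 * ((1 - \<delta>) * (1 - \<delta>)) - 1"
        by simp
      moreover have "2 * ((1 - \<delta>) * (1 - \<delta>)) - 1 = 1 - 4 * \<delta> + 2 * \<delta>\<^sup>2"
        by (simp add: power2_eq_square algebra_simps)
      moreover have "1 - 4 * \<delta> + 2 * \<delta>\<^sup>2 \<ge> 1 - \<eta>"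
        using \<delta> zero_le_power2[of \<delta>] by linarith
      ultimately show ?thesis by linarith
    qed
    then show "\<exists>a b. a < b \<and> (\<forall>n. 1 - \<eta> < measure (\<mu> n) {a<..b})"
      using Y(1) by (intro exI[of _ "- Y"] exI[of _ Y]) auto
  qed
  from tight_imp_convergent_subsubsequence[OF this strict_mono_id]
  obtain r M where r: "strict_mono (r :: nat \<Rightarrow> nat)" and M: "real_distribution M"
    and conv: "weak_conv_m (\<lambda>n. \<mu> (r n)) M"
    by (auto simp: o_def)
  interpret M: real_distribution M by (rule M)
  \<comment> \<open>The kernel is bounded and continuous in t, so weak convergence applies to the
    integrals, while continuity of f at z takes care of the values at the shifted points.\<close>
  have ImM: "(\<integral>t. 1 / (norm (of_real t - z))\<^sup>2 \<partial>M) = Im (f z) / (c * Im z)" if z: "Im z > 0" for z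
  proof -
    have nz: "complex_of_real t \<noteq> z" for t
      using z by (auto simp: complex_eq_iff)
    have cont: "isCont (\<lambda>t. 1 / (norm (of_real t - z))\<^sup>2) t" for t
      using nz by (intro continuous_intros) auto
    have bound: "norm (1 / (norm (of_real t - z))\<^sup>2) \<le> 1 / (Im z)\<^sup>2" for t
      using power_mono[OF norm_cauchy_kernel_le[of z t], of 2] z by (simp add: norm_divide power_divide)
    have "(\<lambda>n. \<integral>t. 1 / (norm (of_real t - z))\<^sup>2 \<partial>\<mu> (r n)) \<longlonglongrightarrow> (\<integral>t. 1 / (norm (of_real t - z))\<^sup>2 \<partial>M)"
      by (rule weak_conv_imp_integral_bdd_continuous_conv[OF dist\<mu> M conv cont bound])
    moreover have "(\<integral>t. 1 / (norm (of_real t - z))\<^sup>2 \<partial>\<mu> n) = Im (f (z + \<i> * of_real (\<epsilon> n))) / (c * Im z)" for n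
      by (subst int\<mu>) (use poisson(2)[OF z, of n] in auto)
    moreover have "(\<lambda>n. Im (f (z + \<i> * of_real (\<epsilon> (r n)))) / (c * Im z)) \<longlonglongrightarrow> Im (f z) / (c * Im z)"
    proof -
      have "\<epsilon> \<longlonglongrightarrow> 0"
        unfolding \<epsilon>_def by real_asymp
      then have "(\<lambda>n. \<epsilon> (r n)) \<longlonglongrightarrow> 0"
        using LIMSEQ_subseq_LIMSEQ[OF _ r] by (simp add: o_def)
      then have "(\<lambda>n. z + \<i> * of_real (\<epsilon> (r n))) \<longlonglongrightarrow> z + \<i> * of_real 0"
        by (intro tendsto_intros)
      moreover have "isCont f z"
        using contf z open_halfspace_Im_gt[of 0] by (simp add: continuous_on_eq_continuous_at)
      ultimately have "(\<lambda>n. f (z + \<i> * of_real (\<epsilon> (r n)))) \<longlonglongrightarrow> f z"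
        by (auto intro: isCont_tendsto_compose)
      then show ?thesis
        using True z by (intro tendsto_intros) auto
    qed
    ultimately show ?thesis
      using LIMSEQ_unique by fastforce
  qed
  define \<sigma> where "\<sigma> = density M (\<lambda>_. ennreal c)"
  have fin: "finite_borel_measure \<sigma>"
  proof (intro finite_borel_measure.intro finite_measureI finite_borel_measure_axioms.intro)
    show "emeasure \<sigma> (space \<sigma>) \<noteq> \<infinity>"
      by (simp add: \<sigma>_def emeasure_density M.emeasure_space_1[simplified])
  qed (simp add: \<sigma>_def)
  interpret \<sigma>: finite_borel_measure \<sigma> by (rule fin)
  let ?F = "\<lambda>z. \<integral>t. 1 / (of_real t - z) \<partial>\<sigma>"
  have ImF: "Im (?F z) = Im (f z)" if z: "Im z > 0" for z
  proof -
    have "(\<integral>t. G t \<partial>\<sigma>) = c * (\<integral>t. G t \<partial>M)" if "G \<in> borel_measurable borel" for G :: "real \<Rightarrow> real"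
      unfolding \<sigma>_def using True that by (subst integral_density) auto
    then have "(\<integral>t. 1 / (norm (of_real t - z))\<^sup>2 \<partial>\<sigma>) = c * (\<integral>t. 1 / (norm (of_real t - z))\<^sup>2 \<partial>M)"
      by simp
    then show ?thesis
      using True z by (simp add: \<sigma>.Im_cauchy_transform ImM)
  qed
  have "(\<lambda>z. f z - ?F z) constant_on {z. Im z > 0}"
    by (intro holomorphic_Im_zero_constant holomorphic_intros nevanlinnaD(1)[OF f]
        \<sigma>.holomorphic_cauchy_transform open_halfspace_Im_gt convex_connected convex_halfspace_Im_gt)
       (simp add: ImF)
  then obtain d where d: "\<And>z. Im z > 0 \<Longrightarrow> f z - ?F z = d"
    by (auto simp: constant_on_def)
  define K where "K = c + measure \<sigma> (space \<sigma>)"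
  have K: "K > 0"
    using True by (simp add: K_def add_pos_nonneg)
  have d_le: "norm d \<le> K / y" if "y > 0" for y
  proof -
    have z: "Im (\<i> * of_real y) > 0" using that by simp
    have "norm (f (\<i> * of_real y)) \<le> c / y"
      using nevanlinna_norm_le'[OF f lim z] by simp
    moreover have "norm (?F (\<i> * of_real y)) \<le> 1 / \<bar>y\<bar> * measure \<sigma> (space \<sigma>)"
      using norm_cauchy_kernel_le[of "\<i> * of_real y"] z
      by (intro \<sigma>.norm_integral_le \<sigma>.integrable_cauchy_kernel) auto
    moreover have "norm d \<le> norm (f (\<i> * of_real y)) + norm (?F (\<i> * of_real y))"
      unfolding d[OF z, symmetric] by (rule norm_triangle_ineq4)
    ultimately show ?thesis
      using that by (simp add: K_def add_divide_distrib)
  qed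
  have "d = 0"
  proof (rule ccontr)
    assume "d \<noteq> 0"
    then show False
      using d_le[of "2 * K / norm d"] K by simp
  qed
  then have upper: "f z = ?F z" if "Im z > 0" for z
    using d[OF that] by simp
  have lower: "f z = ?F z" if "Im z < 0" for z
  proof -
    have "f z = cnj (?F (cnj z))"
      using nevanlinnaD(3)[OF f that] upper[of "cnj z"] that by simp
    also have "\<dots> = (\<integral>t. cnj (1 / (of_real t - cnj z)) \<partial>\<sigma>)"
      by (rule Bochner_Integration.integral_cnj[symmetric])
    finally show ?thesis by simp
  qed
  have "represents \<sigma> f"
    unfolding represents_def using fin upper lower
    by (metis linorder_neqE_linordered_idom)
  then show ?thesis ..
qed

subsection \<open>The Schur transform\<close>

lemma represents_spectral_measure:
  assumes "f \<in> nevanlinna" "has_moment_expansion f s q"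
  shows "represents (spectral_measure f) f"
  using nevanlinna_representation[OF assms(1) has_moment_expansion_lead[OF assms(2)]]
  unfolding spectral_measure_def by (rule someI_ex)

text \<open>With w = 1/z the expansion reads n = - w A(w), where A is the generating series of s.
  Then - s_0 / n = z T(w) for T = s_0 / A, and these are the coefficients of T; the k-th depends
  only on \<open>s 0, ..., s k\<close>.\<close>

definition schur_coeff :: "(nat \<Rightarrow> real) \<Rightarrow> nat \<Rightarrow> real" where
  "schur_coeff s = fps_nth (fps_const (s 0) * inverse (Abs_fps s))"

lemma schur_coeff_convolution:
  assumes "s 0 \<noteq> 0"
  shows "(\<Sum>i\<le>n. s i * schur_coeff s (n - i)) = (if n = 0 then s 0 else 0)"
proof -
  define T where "T = fps_const (s 0) * inverse (Abs_fps s)"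
  have "inverse (Abs_fps s) * Abs_fps s = 1"
    by (rule inverse_mult_eq_1) (simp add: assms)
  then have "Abs_fps s * T = fps_const (s 0)"
    unfolding T_def by (metis mult.commute mult.left_commute mult_1_right)
  then have "fps_nth (Abs_fps s * T) n = fps_nth (fps_const (s 0)) n"
    by (rule arg_cong)
  then show ?thesis
    by (simp add: fps_mult_nth schur_coeff_def T_def[symmetric] atLeast0AtMost)
qed

lemma schur_coeff_0_1:
  assumes "s 0 \<noteq> 0"
  shows "schur_coeff s 0 = 1" "schur_coeff s (Suc 0) = - (s 1 / s 0)"
  using schur_coeff_convolution[of s 0] schur_coeff_convolution[of s 1] assms
  by (simp_all add: field_simps eq_neg_iff_add_eq_0)

text \<open>The leading part 1 - (s_1/s_0) w of T cancels against - z + s_1/s_0 in the Schur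
  transform, so the moments start at the coefficient of w^2; the sign is that of the Stieltjes
  expansion.\<close>

definition schur_moment :: "(nat \<Rightarrow> real) \<Rightarrow> nat \<Rightarrow> real" where
  "schur_moment s j = - schur_coeff s (j + 2)"

text \<open>Coefficient m + 1 of the identity A T = s_0, with the terms for T_0 = 1 and T_1 = -
  s_1/s_0 split off. As a formal identity it holds for every m.\<close>

lemma schur_moments_schur_moment:
  assumes "s 0 \<noteq> 0"
  shows "schur_moments s (schur_moment s) (s 1 / s 0)"
proof
  fix m
  have "0 = (\<Sum>i\<le>Suc m. s i * schur_coeff s (Suc m - i))"
    using schur_coeff_convolution[of s, OF assms, of "Suc m"] by simp
  also have "\<dots> = (\<Sum>i<m. s i * schur_coeff s (Suc m - i)) + s m * schur_coeff s (Suc 0) + s (Suc m)"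
    using schur_coeff_0_1[of s, OF assms] by (simp add: lessThan_Suc_atMost[symmetric])
  also have "(\<Sum>i<m. s i * schur_coeff s (Suc m - i)) = - (\<Sum>i<m. s i * schur_moment s (m - 1 - i))"
    unfolding sum_negf[symmetric]
  proof (rule sum.cong)
    fix i assume "i \<in> {..<m}"
    then have "m - 1 - i + 2 = Suc m - i" by auto
    then show "s i * schur_coeff s (Suc m - i) = - (s i * schur_moment s (m - 1 - i))"
      by (simp add: schur_moment_def)
  qed simp
  finally show "s (Suc m) - s 1 / s 0 * s m = (\<Sum>i<m. s i * schur_moment s (m - 1 - i))"
    by (simp add: schur_coeff_0_1[of s, OF assms] algebra_simps)
qed

text \<open>With A and T truncated to polynomials in w = 1/z, the scaled error of the Schur
  transform becomes an explicit quotient of such polynomials and the scaled error \<open>R\<close>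
  of n, whose limit is immediate. The index shift by two in \<open>schur_moment\<close> lowers the
  order from \<open>Suc q\<close> to \<open>q\<close>.\<close>

lemma schur_transform_expansion:
  assumes exp: "has_moment_expansion n s (Suc q)" and s0: "s 0 \<noteq> 0"
  shows "has_moment_expansion (schur_transform s n) (schur_moment s) q"
proof -
  let ?z = "\<lambda>y::real. \<i> * of_real y"
  let ?N = "2 * Suc q"
  define A where "A = (\<Sum>j\<le>?N. Polynomial.monom (complex_of_real (s j)) j)"
  define T where "T = (\<Sum>j\<le>?N. Polynomial.monom (complex_of_real (schur_coeff s j)) j)"
  have coeffs: "poly.coeff A j = (if j \<le> ?N then of_real (s j) else 0)"
    "poly.coeff T j = (if j \<le> ?N then of_real (schur_coeff s j) else 0)" for j
    by (simp_all add: A_def T_def coeff_sum if_distrib cong: if_cong)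
  \<comment> \<open>Truncation keeps the identity A T = s_0 modulo w^(N + 1); the excess is
    collected in \<open>C\<close>.\<close>
  have "Polynomial.monom 1 (?N + 1) dvd A * T - [:of_real (s 0):]"
    unfolding monom_1_dvd_iff'
  proof (intro allI impI)
    fix m assume "m < ?N + 1"
    then have "poly.coeff (A * T) m = (\<Sum>i\<le>m. of_real (s i * schur_coeff s (m - i)))"
      unfolding coeff_mult by (intro sum.cong) (auto simp: coeffs)
    also have "\<dots> = of_real (if m = 0 then s 0 else 0)"
      unfolding of_real_sum[symmetric] schur_coeff_convolution[of s, OF s0] ..
    finally show "poly.coeff (A * T - [:of_real (s 0):]) m = 0"
      by (auto simp: coeff_pCons split: nat.splits)
  qed
  then obtain C where C: "A * T - [:of_real (s 0):] = Polynomial.monom 1 (?N + 1) * C"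
    by (elim dvdE)
  have AT: "poly A w * poly T w = of_real (s 0) + w ^ (?N + 1) * poly C w" for w
    using arg_cong[OF C, of "\<lambda>p. poly p w"] by (simp add: poly_monom algebra_simps)
  have polyA: "poly A w = (\<Sum>j\<le>?N. of_real (s j) * w ^ j)"
    and polyT: "poly T w = (\<Sum>j\<le>?N. of_real (schur_coeff s j) * w ^ j)" for w
    by (simp_all add: A_def T_def poly_sum poly_monom)
  define R where "R y = (n (?z y) - (\<Sum>j\<le>?N. - of_real (s j) / ?z y ^ (j+1))) / (1 / ?z y ^ (?N+1))" for y
  have R: "(R \<longlongrightarrow> 0) at_infinity"
    using exp unfolding has_moment_expansion_def R_def[abs_def] by (rule smalloD_tendsto)
  have inv: "((\<lambda>y. 1 / ?z y) \<longlongrightarrow> 0) at_infinity"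
  proof -
    have "((\<lambda>y. - \<i> * of_real (inverse y)) \<longlongrightarrow> - \<i> * of_real 0) at_infinity"
      by (intro tendsto_intros tendsto_inverse_0)
    then show ?thesis
      by (simp add: divide_inverse)
  qed
  have polylim: "((\<lambda>y. poly P (1 / ?z y)) \<longlongrightarrow> poly P 0) at_infinity" for P
    by (intro tendsto_poly inv)
  have A0: "poly A 0 = of_real (s 0)"
    using coeffs(1)[of 0] by (simp add: poly_0_coeff_0)
  have denom: "((\<lambda>y. poly A (1 / ?z y) - R y * (1 / ?z y) ^ ?N) \<longlongrightarrow> of_real (s 0)) at_infinity"
    using tendsto_diff[OF polylim[of A] tendsto_mult[OF R tendsto_power[OF inv, of ?N]]] by (simp add: A0)
  have main: "((\<lambda>y. (- (1 / ?z y) * poly C (1 / ?z y) + R y * poly T (1 / ?z y))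
      / (poly A (1 / ?z y) - R y * (1 / ?z y) ^ ?N)) \<longlongrightarrow> (- 0 * poly C 0 + 0 * poly T 0) / of_real (s 0)) at_infinity"
    by (intro tendsto_intros inv polylim R denom) (use s0 in auto)
  have ev0: "\<forall>\<^sub>F y::real in at_infinity. y \<noteq> 0"
    unfolding eventually_at_infinity by (intro exI[of _ 1]) auto
  have "\<forall>\<^sub>F y in at_infinity. poly A (1 / ?z y) - R y * (1 / ?z y) ^ ?N \<noteq> 0"
    by (rule tendsto_imp_eventually_ne[OF denom]) (use s0 in simp)
  with ev0 have "\<forall>\<^sub>F y in at_infinity. (- (1 / ?z y) * poly C (1 / ?z y) + R y * poly T (1 / ?z y))
      / (poly A (1 / ?z y) - R y * (1 / ?z y) ^ ?N)
    = (schur_transform s n (?z y) - (\<Sum>j\<le>2*q. - of_real (schur_moment s j) / ?z y ^ (j+1)))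
      / (1 / ?z y ^ (2*q+1))"
  proof eventually_elim
    case (elim y)
    define z where "z = ?z y"
    define w where "w = 1 / z"
    have z: "z \<noteq> 0" using elim by (simp add: z_def)
    then have wz: "w * z = 1" "z = 1 / w" "w \<noteq> 0"
      by (simp_all add: w_def)
    have wp: "w ^ k * z ^ k = 1" for k
      using wz(1) by (simp add: power_mult_distrib[symmetric])
    define d where "d = poly A w - R y * w ^ ?N"
    have d: "d \<noteq> 0" using elim by (simp add: d_def w_def z_def)
    have "(\<Sum>j\<le>?N. - of_real (s j) / z ^ (j+1)) = - (w * poly A w)"
      unfolding polyA sum_distrib_left sum_negf[symmetric]
      by (rule sum.cong) (auto simp: w_def power_one_over)
    then have "R y = (n z + w * poly A w) * z ^ (?N + 1)"
      by (simp add: R_def z_def[symmetric])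
    then have "R y * w ^ ?N * w = (n z + w * poly A w) * (w ^ (?N+1) * z ^ (?N + 1))"
      by (simp add: mult_ac)
    \<comment> \<open>The expansion solved for n: \<open>d\<close> is A(w) up to a term of order
      w^N, hence nonzero far out.\<close>
    then have nz: "n z = - w * d"
      unfolding wp d_def by (simp add: algebra_simps)
    have "z * poly T w = z - of_real (s 1 / s 0) - (\<Sum>j\<le>2*q. of_real (schur_moment s j) / z ^ (j+1))"
    proof -
      have "poly T w = 1 - of_real (s 1 / s 0) * w - (\<Sum>j\<le>2*q. of_real (schur_moment s j) * w ^ (j + 2))"
        unfolding polyT mult_Suc_right
        by (simp add: sum.atMost_Suc_shift schur_coeff_0_1[of s, OF s0] schur_moment_def sum_negf del: sum.atMost_Suc)
      moreover have "z * (of_real (schur_moment s j) * w ^ (j + 2)) = of_real (schur_moment s j) / z ^ (j+1)" for j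
        using z by (simp add: w_def power_one_over)
      ultimately show ?thesis
        using wz(1) by (simp add: right_diff_distrib sum_distrib_left mult_ac)
    qed
    then have "schur_transform s n z - (\<Sum>j\<le>2*q. - of_real (schur_moment s j) / z ^ (j+1))
        = - of_real (s 0) / n z - z * poly T w"
      by (simp add: schur_transform_def sum_negf)
    also have "\<dots> = z * ((of_real (s 0) - d * poly T w) / d)"
      using d wz by (simp add: nz field_simps)
    also have "of_real (s 0) - d * poly T w = w ^ ?N * (- w * poly C w + R y * poly T w)"
      using AT[of w] by (simp add: d_def algebra_simps)
    finally have "(schur_transform s n z - (\<Sum>j\<le>2*q. - of_real (schur_moment s j) / z ^ (j+1))) / (1 / z ^ (2*q+1))
        = (w ^ ?N * z ^ ?N) * ((- w * poly C w + R y * poly T w) / d)"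
      by (simp add: mult_ac)
    then show ?case
      unfolding wp by (simp add: w_def z_def d_def)
  qed
  from Lim_transform_eventually[OF main this]
  have "((\<lambda>y. (schur_transform s n (?z y) - (\<Sum>j\<le>2*q. - of_real (schur_moment s j) / ?z y ^ (j+1)))
      / (1 / ?z y ^ (2*q+1))) \<longlongrightarrow> 0) at_infinity"
    by simp
  then show ?thesis
    unfolding has_moment_expansion_def
    by (rule smalloI_tendsto) (use ev0 in eventually_elim, simp)
qed

text \<open>The imaginary part of - s_0 / n, namely s_0 Im n / |n|^2, is at least Im z by
  \<open>nevanlinna_norm_le\<close> with c = s_0. A zero of n in the upper half plane would make the
  measure null, contrary to its mass s_0 > 0.\<close>

lemma schur_transform_nevanlinna:
  assumes n: "n \<in> nevanlinna" and exp: "has_moment_expansion n s q" and s0: "s 0 > 0"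
  shows "schur_transform s n \<in> nevanlinna"
proof -
  have rep: "represents (spectral_measure n) n"
    by (rule represents_spectral_measure[OF n exp])
  then interpret finite_borel_measure "spectral_measure n"
    by (simp add: represents_def)
  have ne: "n z \<noteq> 0" if "Im z > 0" for z
  proof
    assume "n z = 0"
    then have "(\<integral>t. 1 / (norm (of_real t - z))\<^sup>2 \<partial>spectral_measure n) = 0"
      using Im_cauchy_transform[of z] rep that by (auto simp: represents_def)
    moreover have "integrable (spectral_measure n) (\<lambda>t. 1 / (norm (of_real t - z))\<^sup>2)"
    proof (rule integrable_const_bound[where B="(1 / \<bar>Im z\<bar>)\<^sup>2"])
      have "norm (1 / (norm (of_real t - z))\<^sup>2) \<le> (1 / \<bar>Im z\<bar>)\<^sup>2" for t
        using power_mono[OF norm_cauchy_kernel_le[of z t], of 2] that by (simp add: norm_divide power_divide)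
      then show "AE t in spectral_measure n. norm (1 / (norm (of_real t - z))\<^sup>2) \<le> (1 / \<bar>Im z\<bar>)\<^sup>2"
        by simp
      have [measurable_cong]: "sets (spectral_measure n) = sets borel"
        by (rule M_is_borel)
      show "(\<lambda>t. 1 / (norm (of_real t - z))\<^sup>2) \<in> borel_measurable (spectral_measure n)"
        by measurable
    qed
    ultimately have "AE t in spectral_measure n. 1 / (norm (of_real t - z))\<^sup>2 = 0"
      by (subst (asm) integral_nonneg_eq_0_iff_AE) auto
    moreover have "complex_of_real t \<noteq> z" for t
      using that by auto
    ultimately have "AE t in spectral_measure n. False"
      by simp
    then have "(\<integral>t. 1 \<partial>spectral_measure n) = (\<integral>t. 0 \<partial>spectral_measure n :: real)"
      by (intro integral_cong_AE) auto
    then show False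
      using has_moments_of_expansion[OF rep exp] s0 by (auto simp: has_moments_def dest!: spec[of _ 0])
  qed
  show ?thesis
    unfolding nevanlinna_def
  proof (intro CollectI conjI allI impI)
    show "schur_transform s n holomorphic_on {z. Im z > 0}"
      unfolding schur_transform_def using ne by (intro holomorphic_intros nevanlinnaD(1)[OF n]) auto
    show "Im (schur_transform s n z) \<ge> 0" if "Im z > 0" for z
    proof -
      have "Im (schur_transform s n z) = s 0 * Im (n z) / (norm (n z))\<^sup>2 - Im z"
        by (simp add: schur_transform_def Im_divide cmod_power2)
      moreover have "Im z \<le> s 0 * Im (n z) / (norm (n z))\<^sup>2"
        using nevanlinna_norm_le[OF n has_moment_expansion_lead[OF exp] that] ne[OF that]
        by (simp add: pos_le_divide_eq)
      ultimately show ?thesis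
        by linarith
    qed
    show "schur_transform s n z = cnj (schur_transform s n (cnj z))" if "Im z < 0" for z
      using nevanlinnaD(3)[OF n that] by (simp add: schur_transform_def)
  qed
qed

section \<open>Complex evaluation of real polynomials and integrals of difference quotients\<close>

lemma cpoly_simps [simp]:
  "cpoly 0 z = 0" "cpoly (pCons a P) z = of_real a + z * cpoly P z"
  by (simp_all add: cpoly_def map_poly_pCons)

lemma cpoly_add [simp]: "cpoly (P + Q) z = cpoly P z + cpoly Q z"
  by (induction P Q rule: poly_induct2) (simp_all add: algebra_simps)

lemma cpoly_smult [simp]: "cpoly (Polynomial.smult c P) z = of_real c * cpoly P z"
  by (induction P) (simp_all add: algebra_simps)

lemma cpoly_diff [simp]: "cpoly (P - Q) z = cpoly P z - cpoly Q z"
  using cpoly_add[of "P - Q" Q z] by (simp add: eq_diff_eq del: cpoly_add)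

lemma cpoly_of_real: "cpoly P (of_real t) = of_real (poly P t)"
  by (induction P) simp_all

text \<open>The recursion of \<open>assoc_poly_pCons\<close> before integration; on the diagonal z =
  t it is the product rule.\<close>

lemma diff_quot_pCons: "diff_quot (pCons a P) z t = of_real (poly P t) + z * diff_quot P z t"
  by (auto simp: diff_quot_def pderiv_pCons cpoly_of_real field_simps)

lemma integral_diff_quot:
  assumes mom: "has_moments \<sigma> s N" and "Polynomial.degree P \<le> N"
  shows "integrable \<sigma> (diff_quot P z) \<and> (\<integral>t. diff_quot P z t \<partial>\<sigma>) = cpoly (assoc_poly s P) z"
  using assms(2)
proof (induction P)
  case 0
  have "diff_quot 0 z = (\<lambda>t. 0)"
    by (simp add: diff_quot_def fun_eq_iff)
  then show ?case by simp
next
  case (pCons a P)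
  then have deg: "Polynomial.degree P \<le> N"
    by (cases "P = 0") auto
  have "integrable \<sigma> (\<lambda>t. complex_of_real (poly P t))"
    using has_moments_poly(1)[OF mom deg] by (intro integrable_of_real)
  then show ?case
    using pCons.IH[OF deg] has_moments_poly(2)[OF mom deg]
    by (simp add: diff_quot_pCons[abs_def] assoc_poly_pCons)
qed

text \<open>In t - a = (z - a) - (z - t) the factor z - t cancels the denominator of the quotient.
  The outcome has the shape of \<open>assoc_assoc_poly\<close>, which is why the inner products
  equal polynomials of the second kind.\<close>

lemma L2_inner_diff_quot:
  assumes mom: "has_moments \<sigma> s N" and deg: "Polynomial.degree P \<le> N"
  shows "L2_inner \<sigma> (diff_quot P z) (\<lambda>t. of_real (t - a))
     = (z - of_real a) * cpoly (assoc_poly s P) z - of_real (s 0) * cpoly P z + of_real (moment_functional s P)"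
proof -
  have eq: "diff_quot P z t * cnj (of_real (t - a))
      = (z - of_real a) * diff_quot P z t - (cpoly P z - of_real (poly P t))" for t
  proof -
    have "(z - of_real t) * diff_quot P z t = cpoly P z - of_real (poly P t)"
      by (auto simp: diff_quot_def cpoly_of_real)
    then show ?thesis
      by (simp add: algebra_simps)
  qed
  have int1: "integrable \<sigma> (\<lambda>t. complex_of_real (poly P t))"
    using has_moments_poly(1)[OF mom deg] by (intro integrable_of_real)
  have int0: "integrable \<sigma> (\<lambda>t. 1 :: real)" "(\<integral>t. 1 \<partial>\<sigma>) = s 0"
    using mom by (auto simp: has_moments_def dest!: spec[of _ 0])
  have const: "integrable \<sigma> (\<lambda>t. cpoly P z)" "(\<integral>t. cpoly P z \<partial>\<sigma>) = of_real (s 0) * cpoly P z"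
  proof -
    have "integrable \<sigma> (\<lambda>t. (1::real) *\<^sub>R cpoly P z)"
      by (rule integrable_scaleR_left) (rule int0(1))
    then show "integrable \<sigma> (\<lambda>t. cpoly P z)" by simp
    show "(\<integral>t. cpoly P z \<partial>\<sigma>) = of_real (s 0) * cpoly P z"
      using int0(2) by (simp add: scaleR_conv_of_real)
  qed
  have dq: "integrable \<sigma> (diff_quot P z)" "(\<integral>t. diff_quot P z t \<partial>\<sigma>) = cpoly (assoc_poly s P) z"
    using integral_diff_quot[OF mom deg] by blast+
  show ?thesis
    unfolding L2_inner_def eq
    using int1 const dq has_moments_poly(2)[OF mom deg] by simp
qed

text \<open>Orthogonality to constants places the zero of e_1 at s_1/s_0, and its norm fixes the
  leading coefficient c by c^2 (s_2 s_0 - s_1^2) = s_0. This makes the two inner product formulas of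
  the theorem agree.\<close>

lemma orthonormal_first:
  assumes e: "orthonormal_upto s e q" and "q \<ge> 1" and s0: "s 0 > 0"
  shows "sqrt (s 2 * s 0 - (s 1)\<^sup>2) / s 0 * poly (e 1) t = 1 / sqrt (s 0) * (t - s 1 / s 0)"
proof -
  have e0: "Polynomial.degree (e 0) = 0" "poly.coeff (e 0) 0 > 0"
    and e1: "Polynomial.degree (e 1) = 1" "poly.coeff (e 1) 1 > 0"
    and ortho: "moment_functional s (e 1 * e 0) = 0" "moment_functional s (e 1 * e 1) = 1"
    using assms(1,2) by (auto simp: orthonormal_upto_def)
  obtain c0 where c0: "e 0 = [:c0:]"
    using e0 by (auto elim: degree_eq_zeroE)
  define b c where "b = poly.coeff (e 1) 0" and "c = poly.coeff (e 1) 1"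
  have e1': "e 1 = [:b, c:]"
    using e1(1) by (intro poly_eqI) (auto simp: b_def c_def coeff_pCons coeff_eq_0 split: nat.splits)
  have c: "c > 0" and "c0 > 0"
    using e0 e1 c0 by (auto simp: c_def)
  have mf: "moment_functional s [:x, y, w:] = x * s 0 + y * s 1 + w * s 2" for x y w
    using moment_functional_eq[of "[:x, y, w:]" 2 s] by (simp add: numeral_2_eq_2)
  have "b * c0 * s 0 + c * c0 * s 1 = 0"
    using ortho(1) mf[of "b * c0" "c * c0" 0] unfolding e1' c0 by (simp add: algebra_simps)
  then have "c0 * (b * s 0 + c * s 1) = 0"
    by (simp only: distrib_left mult_ac)
  then have "b * s 0 + c * s 1 = 0"
    using \<open>c0 > 0\<close> by (metis mult_eq_0_iff less_irrefl)
  then have b: "b = - c * (s 1 / s 0)"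
    using s0 by (simp add: field_simps eq_neg_iff_add_eq_0)
  have "b * b * s 0 + 2 * b * c * s 1 + c * c * s 2 = 1"
    using ortho(2) mf[of "b * b" "2 * b * c" "c * c"] unfolding e1' by (simp add: algebra_simps)
  then have "c\<^sup>2 * (s 2 * s 0 - (s 1)\<^sup>2) = s 0"
    using s0 by (simp add: b field_simps power2_eq_square)
  then have "s 2 * s 0 - (s 1)\<^sup>2 = s 0 / c\<^sup>2"
    using c by (simp add: field_simps)
  then have root: "sqrt (s 2 * s 0 - (s 1)\<^sup>2) = sqrt (s 0) / c"
    using c by (simp add: real_sqrt_divide)
  have "poly (e 1) t = c * (t - s 1 / s 0)"
    unfolding e1' b by (simp add: algebra_simps)
  then have "sqrt (s 2 * s 0 - (s 1)\<^sup>2) / s 0 * poly (e 1) t = sqrt (s 0) / s 0 * (t - s 1 / s 0)"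
    unfolding root using c by simp
  also have "sqrt (s 0) / s 0 = 1 / sqrt (s 0)"
    using s0 by (simp add: real_div_sqrt field_simps)
  finally show ?thesis .
qed

theorem theorem4p2:
  fixes p :: nat and n n' :: "complex \<Rightarrow> complex" and s :: "nat \<Rightarrow> real"
    and a0 b0 :: real and \<sigma> :: "real measure"
    and e e' :: "nat \<Rightarrow> real poly" and d d' :: "nat \<Rightarrow> complex \<Rightarrow> complex"
  defines "n' \<equiv> schur_transform s n"
    and "\<sigma> \<equiv> spectral_measure n"
    and "e \<equiv> first_kind n" and "d \<equiv> second_kind n"
    and "e' \<equiv> first_kind n'" and "d' \<equiv> second_kind n'"
    and "a0 \<equiv> s 1 / s 0" and "b0 \<equiv> sqrt (s 2 * s 0 - (s 1)\<^sup>2) / s 0"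
  assumes "p \<ge> 2"
    and "n \<in> nevanlinna"
    and "has_moment_expansion n s p"
    and "hankel_det s p \<noteq> 0"
  shows "\<forall>k<p. \<forall>z::complex.
      cpoly (e' k) z = of_real (1 / sqrt (s 0)) * d (k+1) z
    \<and> d' k z = - of_real (sqrt (s 0)) * cpoly (e (k+1)) z
               + of_real (1 / sqrt (s 0)) * (z - of_real (s 1 / s 0)) * d (k+1) z
    \<and> d' k z = of_real b0 *
               L2_inner \<sigma> (diff_quot (e (k+1)) z) (\<lambda>t. of_real (poly (e 1) t))
    \<and> d' k z = of_real (1 / sqrt (s 0)) *
               L2_inner \<sigma> (diff_quot (e (k+1)) z) (\<lambda>t. of_real (t - a0))"
proof (intro allI impI)
  fix k z assume k: "k < p"
  define s' where "s' = schur_moment s"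
  define \<sigma>' where "\<sigma>' = spectral_measure n'"
  \<comment> \<open>The Schur transform has moments up to 2 q = 2 p - 2, enough for the indices k
    \<le> q.\<close>
  obtain q where q: "p = Suc q"
    using \<open>p \<ge> 2\<close> by (cases p) auto
  have mom: "has_moments \<sigma> s (2 * p)"
    unfolding \<sigma>_def
    by (rule has_moments_of_expansion[OF represents_spectral_measure[OF assms(10,11)] assms(11)])
  note pos = hankel_positive_definite[OF mom assms(12)]
  \<comment> \<open>Positivity of L on the square of the constant polynomial 1.\<close>
  have s0: "s 0 > 0"
    using pos[of 1] moment_functional_monom[of s 1 0] by simp
  interpret schur_moments s s' a0
    unfolding s'_def a0_def using s0 by (intro schur_moments_schur_moment) simp
  have exp': "has_moment_expansion n' s' q"
    unfolding n'_def s'_def using assms(11) s0 by (intro schur_transform_expansion) (simp_all add: q)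
  have n': "n' \<in> nevanlinna"
    unfolding n'_def by (rule schur_transform_nevanlinna[OF assms(10,11) s0])
  have mom': "has_moments \<sigma>' s' (2 * q)"
    unfolding \<sigma>'_def
    by (rule has_moments_of_expansion[OF represents_spectral_measure[OF n' exp'] exp'])
  have e: "orthonormal_upto s e p"
    unfolding e_def first_kind_def[abs_def] \<sigma>_def[symmetric] by (rule orthonormal_poly_exists[OF mom pos])
  have dege: "Polynomial.degree (e (k+1)) = k + 1"
    using e k by (simp add: orthonormal_upto_def)
  define D where "D = assoc_poly s (e (k+1))"
  \<comment> \<open>\<open>orthonormal_transform\<close> provides an orthonormal system for
    \<open>s'\<close>, which Gram--Schmidt for \<open>\<sigma>'\<close> must return.\<close>
  have e': "e' k = Polynomial.smult (1 / sqrt (s 0)) D"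
    unfolding e'_def first_kind_def \<sigma>'_def[symmetric] D_def
    using orthonormal_poly_unique[OF mom' orthonormal_transform[OF e s0]] k by (simp add: q)
  have dege': "Polynomial.degree (e' k) \<le> 2 * q"
    using degree_assoc_poly_le[of s "e (k+1)"] dege k by (simp add: e' D_def q)
  have d: "d (k+1) z = cpoly D z"
    using integral_diff_quot[OF mom, of "e (k+1)" z] dege k
    by (simp add: d_def second_kind_def \<sigma>_def e_def D_def)
  \<comment> \<open>Orthogonality of e_{k+1} to the constant e_0; it removes the term L P from
    \<open>assoc_assoc_poly\<close> and \<open>L2_inner_diff_quot\<close>, leaving the same
    expression in both.\<close>
  have "moment_functional s (e (k+1)) = 0"
  proof -
    obtain c where c: "e 0 = [:c:]" "c > 0"
      using e by (auto simp: orthonormal_upto_def elim!: degree_eq_zeroE)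
    have "moment_functional s (e (k+1) * e 0) = 0"
      using e k by (simp add: orthonormal_upto_def)
    then show ?thesis
      using c by simp
  qed
  note L2 = L2_inner_diff_quot[OF mom, of "e (k+1)" z a0, unfolded this D_def[symmetric]]
  have d': "d' k z = of_real (1 / sqrt (s 0)) *
      ((z - of_real a0) * cpoly D z - of_real (s 0) * cpoly (e (k+1)) z)"
  proof -
    have "d' k z = cpoly (assoc_poly s' (e' k)) z"
      using integral_diff_quot[OF mom' dege', of z] by (simp add: d'_def second_kind_def \<sigma>'_def e'_def)
    also have "\<dots> = of_real (1 / sqrt (s 0)) * cpoly (assoc_poly s' D) z"
      by (simp add: e' assoc_poly_smult)
    also have "assoc_poly s' D = [:- a0, 1:] * D - Polynomial.smult (s 0) (e (k+1))"
      unfolding D_def assoc_assoc_poly using \<open>moment_functional s (e (k+1)) = 0\<close> by simp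
    finally show ?thesis
      by (simp add: algebra_simps)
  qed
  have 4: "d' k z = of_real (1 / sqrt (s 0)) * L2_inner \<sigma> (diff_quot (e (k+1)) z) (\<lambda>t. of_real (t - a0))"
    unfolding d' using L2 dege k by simp
  have 3: "d' k z = of_real b0 * L2_inner \<sigma> (diff_quot (e (k+1)) z) (\<lambda>t. of_real (poly (e 1) t))"
  proof -
    have "b0 * poly (e 1) t = 1 / sqrt (s 0) * (t - a0)" for t
      unfolding b0_def a0_def by (rule orthonormal_first[OF e _ s0]) (use \<open>p \<ge> 2\<close> in simp)
    then have "of_real b0 * (x * cnj (of_real (poly (e 1) t)))
        = of_real (1 / sqrt (s 0)) * (x * cnj (of_real (t - a0)))" for x t
      by (metis (no_types, lifting) complex_cnj_complex_of_real mult.left_commute of_real_mult)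
    then show ?thesis
      unfolding 4 L2_inner_def integral_mult_right_zero[symmetric] by simp
  qed
  have 2: "d' k z = - of_real (sqrt (s 0)) * cpoly (e (k+1)) z
               + of_real (1 / sqrt (s 0)) * (z - of_real (s 1 / s 0)) * d (k+1) z"
  proof -
    have "complex_of_real (1 / sqrt (s 0)) * of_real (s 0) = of_real (sqrt (s 0))"
      using s0 by (simp only: of_real_mult[symmetric]) (simp add: real_div_sqrt)
    then show ?thesis
      unfolding d' d a0_def[symmetric] by (simp only: right_diff_distrib mult.assoc[symmetric]) simp
  qed
  have 1: "cpoly (e' k) z = of_real (1 / sqrt (s 0)) * d (k+1) z"
    unfolding e' d by simp
  show "cpoly (e' k) z = of_real (1 / sqrt (s 0)) * d (k+1) z
    \<and> d' k z = - of_real (sqrt (s 0)) * cpoly (e (k+1)) z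
               + of_real (1 / sqrt (s 0)) * (z - of_real (s 1 / s 0)) * d (k+1) z
    \<and> d' k z = of_real b0 *
               L2_inner \<sigma> (diff_quot (e (k+1)) z) (\<lambda>t. of_real (poly (e 1) t))
    \<and> d' k z = of_real (1 / sqrt (s 0)) *
               L2_inner \<sigma> (diff_quot (e (k+1)) z) (\<lambda>t. of_real (t - a0))"
    using 1 2 3 4 by blast
qed

end
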